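(* Consider the ADMM iteration defined in the context for the scenario model predictive control problem with prediction horizon $N$ and $S$ scenarios. Counting each scalar arithmetic operation or comparison, and each solution of a one-dimensional convex minimization problem over a closed bounded interval, as one unit of computation, each iteration (that is, the updates of $(u,x)$, of $(\tau,\zeta)$ and of $\lambda=(\nu,\psi,\phi)$, together with the evaluation of the residuals $r^{(i+1)}$ and $s^{(i+1)}$) can be carried out sequentially with $\mathcal{O}(NS)$ computation and $\mathcal{O}(NS)$ memory.
   Context: Problem data: $N,S\in\mathbb{Z}_{++}$; $x(t)\in\mathbb{R}$; $\mathcal{X}=[\underline{x},\overline{x}]\subset\mathbb{R}$; for each $k\in\{0,\dots,N-1\}$, $s\in\{1,\dots,S\}$ an interval $\mathcal{U}_{k,s}=[\underline{u}_{k,s},\overline{u}_{k,s}]$; sets $\mathcal{P}_s\subseteq\{0,\dots,N-1\}$ (times at which the engine is on; for $k\notin\mathcal{P}_s$ the battery power is fixed, $\underline{u}_{k,s}=\overline{u}_{k,s}$); and for each $s$ and $k\in\mathcal{P}_s$ a convex function $F_{k,s}:\mathcal{U}_{k,s}\to\mathbb{R}$, where $F_{k,s}(u)=f_{k,s}(p_{k,s}-g_{k,s}^{-1}(u))$ is the predicted fuel consumption as a function of battery power. Here $p_{k,s}\in\mathbb{R}$ is the powertrain output power, $f_{k,s}$ is a strictly convex quadratic, and $$g_{k,s}^{-1}(u)=-\frac{\beta_{1,k,s}}{2\beta_{2,k,s}}+\sqrt{-\frac{R_{k}u^2}{\beta_{2,k,s}V_{k}^2}+\frac{u-\beta_{0,k,s}}{\beta_{2,k,s}}+\frac{\beta_{1,k,s}^2}{4\beta_{2,k,s}^2}},\qquad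 \beta_{2,k,s},R_k,V_k>0.$$ The scenario MPC problem is: minimize $\frac1S\sum_{s=1}^S\sum_{k\in\mathcal{P}_s}F_{k,s}(u_{k,s})$ over $u,x\in\mathbb{R}^{N\times S}$ (rows of $u$ indexed $0,\dots,N-1$, rows of $x$ indexed $1,\dots,N$) and $\tau\in\mathbb{R}$, subject to, for all $s$: $x_{:,s}=\mathbf{1}x(t)-\Psi u_{:,s}$, $\ \mathbf{1}\underline{x}\le x_{:,s}\le\mathbf{1}\overline{x}$, $\ \underline{u}_{:,s}\le u_{:,s}\le\overline{u}_{:,s}$, $\ u_{0,s}=\tau$, where $\Psi\in\mathbb{R}^{N\times N}$ is the lower triangular matrix of ones and $\mathbf{1}$ is a vector of ones. Introduce $\zeta\in\mathbb{R}^{N\times S}$, scaled multipliers $\nu,\psi\in\mathbb{R}^{N\times S}$, $\phi\in\mathbb{R}^S$, $\lambda=(\mathrm{vec}(\nu),\mathrm{vec}(\psi),\phi)$ (where $\mathrm{vec}$ stacks columns), and penalty parameters $\rho_1,\rho_2,\rho_3>0$. Write $\mathcal{I}_C$ for the indicator function of $C$ ($0$ on $C$, $+\infty$ off $C$). The augmented Lagrangian is $$\mathcal{L}_\rho(\tilde u,\tilde x,\lambda)=\frac1S\sum_{s=1}^S\Big(\sum_{k\in\mathcal{P}_s}F_{k,s}(u_{k,s})+\sum_{k=0}^{N-1}\big(\mathcal{I}_{\mathcal{U}_{k,s}}(u_{k,s})+\mathcal{I}_{\mathcal{X}}(x_{k+1,s})\big)+\frac{\rho_1}{2}\|u_{:,s}-\zeta_{:,s}+\nu_{:,s}\|^2+\frac{\rho_2}{2}\|x_{:,s}+\Psi\zeta_{:,s}-\mathbf{1}x(t)+\psi_{:,s}\|^2+\frac{\rho_3}{2}(\tau-u_{0,s}+\phi_s)^2\Big),$$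 with $\tilde u=(\mathrm{vec}(u),\mathrm{vec}(x))$ and $\tilde x=(\tau,\mathrm{vec}(\zeta))$. One ADMM iteration is $$\tilde u^{(i+1)}=\arg\min_{\tilde u}\mathcal{L}_\rho(\tilde u,\tilde x^{(i)},\lambda^{(i)}),\qquad \tilde x^{(i+1)}=\arg\min_{\tilde x}\mathcal{L}_\rho(\tilde u^{(i+1)},\tilde x,\lambda^{(i)}),\qquad \lambda^{(i+1)}=\lambda^{(i)}+r^{(i+1)},$$ where $r^{(i+1)}$ consists of the three blocks $\mathrm{vec}(u^{(i+1)})-\mathrm{vec}(\zeta^{(i+1)})$; $\ \mathrm{vec}(x^{(i+1)})-\mathbf{1}x(t)+(\Psi\zeta^{(i+1)}_{:,1},\dots,\Psi\zeta^{(i+1)}_{:,S})$; and $\mathbf{1}\tau^{(i+1)}-(u^{(i+1)}_{0,:})^\top$. The other residual $s^{(i+1)}$ consists of the two blocks $\rho_1\mathrm{vec}(\zeta^{(i)}-\zeta^{(i+1)})-M(\tau^{(i)}-\tau^{(i+1)})$, with $M=\rho_3(\mathbf{1}_S\otimes[1,0,\dots,0]^\top)\in\mathbb{R}^{NS}$, and $\rho_2\big(\Psi(\zeta^{(i)}_{:,1}-\zeta^{(i+1)}_{:,1}),\dots,\Psi(\zeta^{(i)}_{:,S}-\zeta^{(i+1)}_{:,S})\big)$. *)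

theory Defs
  imports "HOL-Analysis.Analysis"
begin

section \<open>The scenario MPC problem and its ADMM iteration\<close>

text \<open>
  Real matrices whose size is only known at run time are functions \<open>w k s\<close> (row \<open>k\<close>, column \<open>s\<close>),
  of which only the entries in range matter. Scenarios are numbered \<open>0, \<dots>, S - 1\<close>; the rows are
  numbered \<open>0, \<dots>, N - 1\<close>, except that the rows of \<open>x\<close> are numbered \<open>1, \<dots>, N\<close>.
\<close>

type_synonym rmat = "nat \<Rightarrow> nat \<Rightarrow> real"

record mpc =
  hor :: nat
  scen :: nat
  x_now :: real
  x_lo :: real
  x_hi :: real
  u_lo :: rmat
  u_hi :: rmat
  eng_on :: "nat \<Rightarrow> nat set"    \<comment> \<open>\<open>eng_on d s\<close> is the set \<open>P\<^sub>s\<close>\<close>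
  fq2 :: rmat                      \<comment> \<open>\<open>f\<^sub>k\<^sub>,\<^sub>s(y) = fq2 k s * y\<^sup>2 + fq1 k s * y + fq0 k s\<close>\<close>
  fq1 :: rmat
  fq0 :: rmat
  p_out :: rmat
  beta0 :: rmat
  beta1 :: rmat
  beta2 :: rmat
  resist :: "nat \<Rightarrow> real"
  volt :: "nat \<Rightarrow> real"
  rho1 :: real
  rho2 :: real
  rho3 :: real

definition fuel_quad :: "mpc \<Rightarrow> nat \<Rightarrow> nat \<Rightarrow> real \<Rightarrow> real" where
  "fuel_quad d k s y = fq2 d k s * y\<^sup>2 + fq1 d k s * y + fq0 d k s"

definition g_inv_radicand :: "mpc \<Rightarrow> nat \<Rightarrow> nat \<Rightarrow> real \<Rightarrow> real" where
  "g_inv_radicand d k s u =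
     - (resist d k * u\<^sup>2) / (beta2 d k s * (volt d k)\<^sup>2)
     + (u - beta0 d k s) / beta2 d k s
     + (beta1 d k s)\<^sup>2 / (4 * (beta2 d k s)\<^sup>2)"

definition g_inv :: "mpc \<Rightarrow> nat \<Rightarrow> nat \<Rightarrow> real \<Rightarrow> real" where
  "g_inv d k s u = - beta1 d k s / (2 * beta2 d k s) + sqrt (g_inv_radicand d k s u)"

definition fuel :: "mpc \<Rightarrow> nat \<Rightarrow> nat \<Rightarrow> real \<Rightarrow> real" where
  "fuel d k s u = fuel_quad d k s (p_out d k s - g_inv d k s u)"

definition U_int :: "mpc \<Rightarrow> nat \<Rightarrow> nat \<Rightarrow> real set" where
  "U_int d k s = {u_lo d k s .. u_hi d k s}"

definition X_int :: "mpc \<Rightarrow> real set" where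
  "X_int d = {x_lo d .. x_hi d}"

definition valid_mpc :: "mpc \<Rightarrow> bool" where
  "valid_mpc d \<longleftrightarrow>
     hor d \<ge> 1 \<and> scen d \<ge> 1 \<and>
     x_lo d \<le> x_hi d \<and>
     rho1 d > 0 \<and> rho2 d > 0 \<and> rho3 d > 0 \<and>
     (\<forall>s<scen d. eng_on d s \<subseteq> {..<hor d}) \<and>
     (\<forall>s<scen d. \<forall>k<hor d. u_lo d k s \<le> u_hi d k s) \<and>
     (\<forall>s<scen d. \<forall>k<hor d. k \<notin> eng_on d s \<longrightarrow> u_lo d k s = u_hi d k s) \<and>
     (\<forall>s<scen d. \<forall>k\<in>eng_on d s.
        fq2 d k s > 0 \<and> beta2 d k s > 0 \<and> resist d k > 0 \<and> volt d k > 0 \<and>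
        (\<forall>u\<in>U_int d k s. g_inv_radicand d k s u \<ge> 0) \<and>
        convex_on (U_int d k s) (fuel d k s))"

definition Psi :: "nat \<Rightarrow> nat \<Rightarrow> real" where
  "Psi k j = (if j \<le> k then 1 else 0)"

definition Psi_mult :: "mpc \<Rightarrow> rmat \<Rightarrow> rmat" where
  "Psi_mult d w k s = (\<Sum>j<hor d. Psi k j * w j s)"

definition ind :: "real set \<Rightarrow> real \<Rightarrow> ereal" where
  "ind C v = (if v \<in> C then 0 else \<infinity>)"

text \<open>The tuples \<open>(u, x)\<close>, \<open>(\<tau>, \<zeta>)\<close> and \<open>(\<nu>, \<psi>, \<phi>)\<close>.\<close>

type_synonym ux = "rmat \<times> rmat"
type_synonym tz = "real \<times> rmat"
type_synonym mult = "rmat \<times> rmat \<times> (nat \<Rightarrow> real)"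

fun lagrangian :: "mpc \<Rightarrow> ux \<Rightarrow> tz \<Rightarrow> mult \<Rightarrow> ereal" where
  "lagrangian d (u, x) (\<tau>, \<zeta>) (\<nu>, \<psi>, \<phi>) =
     ereal (1 / real (scen d)) * (\<Sum>s<scen d.
         ereal (\<Sum>k\<in>eng_on d s. fuel d k s (u k s))
       + (\<Sum>k<hor d. ind (U_int d k s) (u k s) + ind (X_int d) (x (Suc k) s))
       + ereal (rho1 d / 2 * (\<Sum>k<hor d. (u k s - \<zeta> k s + \<nu> k s)\<^sup>2))
       + ereal (rho2 d / 2 * (\<Sum>k<hor d. (x (Suc k) s + Psi_mult d \<zeta> k s - x_now d + \<psi> k s)\<^sup>2))
       + ereal (rho3 d / 2 * (\<tau> - u 0 s + \<phi> s)\<^sup>2))"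

text \<open>The three residual blocks are indexed like \<open>\<nu>\<close>, \<open>\<psi>\<close> and \<open>\<phi>\<close>.\<close>

fun residual_r :: "mpc \<Rightarrow> ux \<Rightarrow> tz \<Rightarrow> mult" where
  "residual_r d (u, x) (\<tau>, \<zeta>) =
     ((\<lambda>k s. u k s - \<zeta> k s),
      (\<lambda>k s. x (Suc k) s - x_now d + Psi_mult d \<zeta> k s),
      (\<lambda>s. \<tau> - u 0 s))"

text \<open>\<open>M_vec d k s\<close> is the entry of \<open>M = \<rho>\<^sub>3 (1 \<otimes> [1, 0, \<dots>, 0])\<close> in position \<open>k\<close> of block \<open>s\<close>.\<close>

definition M_vec :: "mpc \<Rightarrow> rmat" where
  "M_vec d k s = rho3 d * (if k = 0 then 1 else 0)"

fun residual_s :: "mpc \<Rightarrow> tz \<Rightarrow> tz \<Rightarrow> rmat \<times> rmat" where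
  "residual_s d (\<tau>, \<zeta>) (\<tau>', \<zeta>') =
     ((\<lambda>k s. rho1 d * (\<zeta> k s - \<zeta>' k s) - M_vec d k s * (\<tau> - \<tau>')),
      (\<lambda>k s. rho2 d * Psi_mult d (\<lambda>k s. \<zeta> k s - \<zeta>' k s) k s))"

fun mult_add :: "mult \<Rightarrow> mult \<Rightarrow> mult" where
  "mult_add (\<nu>, \<psi>, \<phi>) (\<nu>', \<psi>', \<phi>') =
     ((\<lambda>k s. \<nu> k s + \<nu>' k s), (\<lambda>k s. \<psi> k s + \<psi>' k s), (\<lambda>s. \<phi> s + \<phi>' s))"

text \<open>
  \<open>admm_iteration d xt l ut' xt' l' r s\<close>: from \<open>xt = (\<tau>, \<zeta>)\<close> and \<open>l = (\<nu>, \<psi>, \<phi>)\<close>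
  one iteration leads to \<open>ut'\<close>, \<open>xt'\<close>, \<open>l'\<close>, with residuals \<open>r\<close> and \<open>s\<close>.
\<close>

definition admm_iteration ::
  "mpc \<Rightarrow> tz \<Rightarrow> mult \<Rightarrow> ux \<Rightarrow> tz \<Rightarrow> mult \<Rightarrow> mult \<Rightarrow> rmat \<times> rmat \<Rightarrow> bool" where
  "admm_iteration d xt l ut' xt' l' r s \<longleftrightarrow>
     is_arg_min (\<lambda>ut. lagrangian d ut xt l) (\<lambda>_. True) ut' \<and>
     is_arg_min (\<lambda>z. lagrangian d ut' z l) (\<lambda>_. True) xt' \<and>
     r = residual_r d ut' xt' \<and>
     l' = mult_add l r \<and>
     s = residual_s d xt xt'"


section \<open>A sequential real random access machine\<close>

text \<open>
  The machine has index registers holding natural numbers and arrays of real numbers; arrays are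
  addressed by index expressions. Reals cannot be converted to indices. Its operations
  are arithmetic, comparisons, and the exact solution of a one-dimensional convex minimization
  problem over a closed bounded interval. Arithmetic on indices is charged as well. Division by
  zero follows the HOL convention \<open>x / 0 = 0\<close>.
\<close>

datatype iexp = INum nat | Reg string | IAdd iexp iexp | ISub iexp iexp | IMul iexp iexp

datatype aop = Add | Sub | Mul | Div

datatype aexp = Const int | Get string iexp | AOp aop aexp aexp

datatype bexp = ILess iexp iexp | ALess aexp aexp

text \<open>Objective functions; \<open>DVar\<close> is the decision variable, \<open>Par e\<close> a parameter computed beforehand.\<close>

datatype oexp = DVar | Par aexp | OOp aop oexp oexp | Sqrt oexp

text \<open>
  \<open>Argmin a i g lo hi\<close> stores in cell \<open>i\<close> of array \<open>a\<close> a minimizer of \<open>g\<close> over \<open>[lo, hi]\<close>.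
\<close>

datatype com =
    Skip
  | SetReg string iexp
  | Store string iexp aexp
  | Argmin string iexp oexp aexp aexp
  | Seq com com
  | Cond bexp com com
  | While bexp com

record machine =
  regs :: "string \<Rightarrow> nat"
  mem :: "string \<Rightarrow> nat \<Rightarrow> real"

datatype cell = RegCell string | MemCell string nat

fun ival :: "iexp \<Rightarrow> machine \<Rightarrow> nat" where
  "ival (INum n) m = n"
| "ival (Reg r) m = regs m r"
| "ival (IAdd a b) m = ival a m + ival b m"
| "ival (ISub a b) m = ival a m - ival b m"
| "ival (IMul a b) m = ival a m * ival b m"

fun aop_val :: "aop \<Rightarrow> real \<Rightarrow> real \<Rightarrow> real" where
  "aop_val Add v w = v + w"
| "aop_val Sub v w = v - w"
| "aop_val Mul v w = v * w"
| "aop_val Div v w = v / w"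

fun aval :: "aexp \<Rightarrow> machine \<Rightarrow> real" where
  "aval (Const c) m = of_int c"
| "aval (Get a i) m = mem m a (ival i m)"
| "aval (AOp f a b) m = aop_val f (aval a m) (aval b m)"

fun bval :: "bexp \<Rightarrow> machine \<Rightarrow> bool" where
  "bval (ILess a b) m \<longleftrightarrow> ival a m < ival b m"
| "bval (ALess a b) m \<longleftrightarrow> aval a m < aval b m"

fun oval :: "oexp \<Rightarrow> machine \<Rightarrow> real \<Rightarrow> real" where
  "oval DVar m v = v"
| "oval (Par e) m v = aval e m"
| "oval (OOp f a b) m v = aop_val f (oval a m v) (oval b m v)"
| "oval (Sqrt a) m v = sqrt (oval a m v)"

text \<open>Number of operations in an expression.\<close>

fun icost :: "iexp \<Rightarrow> nat" where
  "icost (INum n) = 0"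
| "icost (Reg r) = 0"
| "icost (IAdd a b) = 1 + icost a + icost b"
| "icost (ISub a b) = 1 + icost a + icost b"
| "icost (IMul a b) = 1 + icost a + icost b"

fun acost :: "aexp \<Rightarrow> nat" where
  "acost (Const c) = 0"
| "acost (Get a i) = icost i"
| "acost (AOp f a b) = 1 + acost a + acost b"

fun bcost :: "bexp \<Rightarrow> nat" where
  "bcost (ILess a b) = 1 + icost a + icost b"
| "bcost (ALess a b) = 1 + acost a + acost b"

text \<open>The operations in the objective itself are charged too, on top of the unit for solving.\<close>

fun ocost :: "oexp \<Rightarrow> nat" where
  "ocost DVar = 0"
| "ocost (Par e) = acost e"
| "ocost (OOp f a b) = 1 + ocost a + ocost b"
| "ocost (Sqrt a) = 1 + ocost a"

text \<open>Cells read by an expression.\<close>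

fun icells :: "iexp \<Rightarrow> cell set" where
  "icells (INum n) = {}"
| "icells (Reg r) = {RegCell r}"
| "icells (IAdd a b) = icells a \<union> icells b"
| "icells (ISub a b) = icells a \<union> icells b"
| "icells (IMul a b) = icells a \<union> icells b"

fun acells :: "aexp \<Rightarrow> machine \<Rightarrow> cell set" where
  "acells (Const c) m = {}"
| "acells (Get a i) m = insert (MemCell a (ival i m)) (icells i)"
| "acells (AOp f a b) m = acells a m \<union> acells b m"

fun bcells :: "bexp \<Rightarrow> machine \<Rightarrow> cell set" where
  "bcells (ILess a b) m = icells a \<union> icells b"
| "bcells (ALess a b) m = acells a m \<union> acells b m"

fun ocells :: "oexp \<Rightarrow> machine \<Rightarrow> cell set" where
  "ocells DVar m = {}"
| "ocells (Par e) m = acells e m"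
| "ocells (OOp f a b) m = ocells a m \<union> ocells b m"
| "ocells (Sqrt a) m = ocells a m"

definition set_reg :: "string \<Rightarrow> nat \<Rightarrow> machine \<Rightarrow> machine" where
  "set_reg r n m = m\<lparr>regs := (regs m)(r := n)\<rparr>"

definition set_mem :: "string \<Rightarrow> nat \<Rightarrow> real \<Rightarrow> machine \<Rightarrow> machine" where
  "set_mem a i v m = m\<lparr>mem := (mem m)(a := (mem m a)(i := v))\<rparr>"

text \<open>
  \<open>run c m t Z m'\<close>: started in \<open>m\<close>, program \<open>c\<close> terminates in \<open>m'\<close> after \<open>t\<close> units of
  computation, and \<open>Z\<close> is the set of all cells read or written. Programs are deterministic.
  \<open>Argmin\<close> is stuck unless its problem is a convex one that has a solution.
\<close>

inductive run :: "com \<Rightarrow> machine \<Rightarrow> nat \<Rightarrow> cell set \<Rightarrow> machine \<Rightarrow> bool" where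
  Skip: "run Skip m 0 {} m"
| SetReg: "run (SetReg r e) m (1 + icost e) (insert (RegCell r) (icells e))
     (set_reg r (ival e m) m)"
| Store: "run (Store a i e) m (1 + icost i + acost e)
     (insert (MemCell a (ival i m)) (icells i \<union> acells e m))
     (set_mem a (ival i m) (aval e m) m)"
| Argmin: "\<lbrakk>D = {aval lo m .. aval hi m}; D \<noteq> {}; convex_on D (oval g m);
      \<exists>v. is_arg_min (oval g m) (\<lambda>v. v \<in> D) v\<rbrakk> \<Longrightarrow>
    run (Argmin a i g lo hi) m (1 + icost i + ocost g + acost lo + acost hi)
     (insert (MemCell a (ival i m)) (icells i \<union> ocells g m \<union> acells lo m \<union> acells hi m))
     (set_mem a (ival i m) (arg_min_on (oval g m) D) m)"
| Seq: "\<lbrakk>run c1 m t1 Z1 m1; run c2 m1 t2 Z2 m2\<rbrakk> \<Longrightarrow>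
    run (Seq c1 c2) m (t1 + t2) (Z1 \<union> Z2) m2"
| CondTrue: "\<lbrakk>bval b m; run c1 m t Z m'\<rbrakk> \<Longrightarrow>
    run (Cond b c1 c2) m (1 + bcost b + t) (bcells b m \<union> Z) m'"
| CondFalse: "\<lbrakk>\<not> bval b m; run c2 m t Z m'\<rbrakk> \<Longrightarrow>
    run (Cond b c1 c2) m (1 + bcost b + t) (bcells b m \<union> Z) m'"
| WhileFalse: "\<not> bval b m \<Longrightarrow> run (While b c) m (1 + bcost b) (bcells b m) m"
| WhileTrue: "\<lbrakk>bval b m; run c m t1 Z1 m1; run (While b c) m1 t2 Z2 m2\<rbrakk> \<Longrightarrow>
    run (While b c) m (1 + bcost b + t1 + t2) (bcells b m \<union> Z1 \<union> Z2) m2"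


section \<open>Representation of the problem data and of the iterates in memory\<close>

definition holds_num :: "machine \<Rightarrow> string \<Rightarrow> real \<Rightarrow> bool" where
  "holds_num m a v \<longleftrightarrow> mem m a 0 = v"

definition holds_vec :: "machine \<Rightarrow> string \<Rightarrow> nat \<Rightarrow> (nat \<Rightarrow> real) \<Rightarrow> bool" where
  "holds_vec m a n v \<longleftrightarrow> (\<forall>i<n. mem m a i = v i)"

text \<open>An \<open>N \<times> S\<close> matrix is stored column by column, as \<open>vec\<close> does.\<close>

definition holds_mat :: "machine \<Rightarrow> string \<Rightarrow> mpc \<Rightarrow> rmat \<Rightarrow> bool" where
  "holds_mat m a d w \<longleftrightarrow> (\<forall>s<scen d. \<forall>k<hor d. mem m a (s * hor d + k) = w k s)"

definition holds_data :: "machine \<Rightarrow> mpc \<Rightarrow> bool" where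
  "holds_data m d \<longleftrightarrow>
     regs m ''N'' = hor d \<and> regs m ''S'' = scen d \<and>
     holds_num m ''x_now'' (x_now d) \<and>
     holds_num m ''x_lo'' (x_lo d) \<and> holds_num m ''x_hi'' (x_hi d) \<and>
     holds_mat m ''u_lo'' d (u_lo d) \<and> holds_mat m ''u_hi'' d (u_hi d) \<and>
     holds_mat m ''eng_on'' d (\<lambda>k s. if k \<in> eng_on d s then 1 else 0) \<and>
     holds_mat m ''fq2'' d (fq2 d) \<and> holds_mat m ''fq1'' d (fq1 d) \<and>
     holds_mat m ''fq0'' d (fq0 d) \<and> holds_mat m ''p_out'' d (p_out d) \<and>
     holds_mat m ''beta0'' d (beta0 d) \<and> holds_mat m ''beta1'' d (beta1 d) \<and>
     holds_mat m ''beta2'' d (beta2 d) \<and>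
     holds_vec m ''resist'' (hor d) (resist d) \<and> holds_vec m ''volt'' (hor d) (volt d) \<and>
     holds_num m ''rho1'' (rho1 d) \<and> holds_num m ''rho2'' (rho2 d) \<and>
     holds_num m ''rho3'' (rho3 d)"

fun holds_ux :: "machine \<Rightarrow> mpc \<Rightarrow> ux \<Rightarrow> bool" where
  "holds_ux m d (u, x) \<longleftrightarrow> holds_mat m ''u'' d u \<and> holds_mat m ''x'' d (\<lambda>k s. x (Suc k) s)"

fun holds_tz :: "machine \<Rightarrow> mpc \<Rightarrow> tz \<Rightarrow> bool" where
  "holds_tz m d (\<tau>, \<zeta>) \<longleftrightarrow> holds_num m ''tau'' \<tau> \<and> holds_mat m ''zeta'' d \<zeta>"

fun holds_mult :: "machine \<Rightarrow> mpc \<Rightarrow> mult \<Rightarrow> bool" where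
  "holds_mult m d (\<nu>, \<psi>, \<phi>) \<longleftrightarrow>
     holds_mat m ''nu'' d \<nu> \<and> holds_mat m ''psi'' d \<psi> \<and> holds_vec m ''phi'' (scen d) \<phi>"

fun holds_residual_r :: "machine \<Rightarrow> mpc \<Rightarrow> mult \<Rightarrow> bool" where
  "holds_residual_r m d (r1, r2, r3) \<longleftrightarrow>
     holds_mat m ''r1'' d r1 \<and> holds_mat m ''r2'' d r2 \<and> holds_vec m ''r3'' (scen d) r3"

fun holds_residual_s :: "machine \<Rightarrow> mpc \<Rightarrow> rmat \<times> rmat \<Rightarrow> bool" where
  "holds_residual_s m d (s1, s2) \<longleftrightarrow> holds_mat m ''s1'' d s1 \<and> holds_mat m ''s2'' d s2"

end

theory Submission
  imports Defs
begin

text \<open>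
  For fixed \<open>(\<tau>, \<zeta>)\<close> and multipliers, the augmented Lagrangian is a sum of terms each of which
  contains a single entry of \<open>u\<close> or of \<open>x\<close> (\<open>smooth_part_separable\<close>), so that minimizing it in
  \<open>(u, x)\<close> amounts to \<open>2NS\<close> one-dimensional convex problems. For fixed \<open>(u, x)\<close> inside the
  bounds, \<open>\<tau>\<close> and the columns of \<open>\<zeta>\<close> decouple: the optimal \<open>\<tau>\<close> is a mean over the scenarios, and
  column \<open>s\<close> of \<open>\<zeta>\<close> minimizes
  \<open>\<rho>\<^sub>1/2 \<parallel>\<zeta> - a\<parallel>\<^sup>2 + \<rho>\<^sub>2/2 \<parallel>\<Psi>\<zeta> - b\<parallel>\<^sup>2\<close> with \<open>a = u + \<nu>\<close> and \<open>b = 1 x(t) - x - \<psi>\<close>.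

  The point of the theorem is that this last problem costs only \<open>O(N)\<close> per scenario, although its
  Hessian \<open>\<rho>\<^sub>1 I + \<rho>\<^sub>2 \<Psi>\<^sup>T\<Psi>\<close> is a dense matrix. It is a scalar linear-quadratic control problem:
  the state is the running sum \<open>y\<close> of \<open>\<zeta>\<close>, the control is \<open>\<zeta>\<close>. The gradient of the second
  term in \<open>\<zeta>\<^sub>k\<close> is \<open>\<rho>\<^sub>2\<close> times the costate \<open>q\<^sub>k = \<Sum>j\<ge>k. y\<^sub>j - b\<^sub>j\<close>, and along an optimal trajectory
  \<open>q\<^sub>k\<close> is an affine function of the sum \<open>\<zeta>\<^sub>0 + \<dots> + \<zeta>\<^sub>k\<^sub>-\<^sub>1\<close> before step \<open>k\<close>
  (\<open>costate_affine\<close>). The coefficients of that function obey a backward Riccati recursion, after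
  which a forward pass yields \<open>\<zeta>\<close>. Multiplication by \<open>\<Psi>\<close>, which also occurs in the residuals,
  is a running sum.

  The program therefore makes two passes over the scenarios, since \<open>\<tau>\<close> needs all columns of the new
  \<open>u\<close>. Correctness and running time of its loops are proved by a small program logic
  (\<open>reaches_wp\<close>, \<open>reaches_For\<close>). Memory needs no separate analysis, because an operation
  touches a bounded number of cells (\<open>run_cells\<close>).
\<close>

section \<open>Timed reasoning about programs\<close>

text \<open>
  An expression is a tree whose inner nodes are the operations that are charged, so it has one leaf
  more than the operations it costs, and only leaves read cells. The factors 2 and 4 below leave
  room for the array cell that is read in addition to the registers of its index.
\<close>

lemma icells_bound: "finite (icells e) \<and> card (icells e) \<le> 1 + icost e"
  by (induction e) (auto intro: order_trans[OF card_Un_le])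

lemma acells_bound: "finite (acells e m) \<and> card (acells e m) \<le> 2 * (1 + acost e)"
proof (induction e)
  case (Get a i)
  show ?case
    using icells_bound[of i] by (simp add: card_insert_if)
qed (auto intro: order_trans[OF card_Un_le])

lemma bcells_bound: "finite (bcells b m) \<and> card (bcells b m) \<le> 4 * (1 + bcost b)"
proof (cases b)
  case (ILess x y)
  then show ?thesis
    using icells_bound[of x] icells_bound[of y] card_Un_le[of "icells x" "icells y"] by simp
next
  case (ALess x y)
  then show ?thesis
    using acells_bound[of x m] acells_bound[of y m] card_Un_le[of "acells x m" "acells y m"] by simp
qed

lemma ocells_bound: "finite (ocells e m) \<and> card (ocells e m) \<le> 2 * (1 + ocost e)"
proof (induction e)
  case (Par e)
  then show ?case using acells_bound[of e m] by simp
qed (auto intro: order_trans[OF card_Un_le])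

text \<open>
  Every execution step costs at least one unit, which pays for the cells that the step touches.
\<close>

lemma run_cells:
  assumes "run c m t Z m'"
  shows "finite Z \<and> card Z \<le> 8 * t"
  using assms
proof (induction rule: run.induct)
  case (SetReg r e m)
  show ?case using icells_bound[of e] by (simp add: card_insert_if)
next
  case (Store a i e m)
  show ?case
    using icells_bound[of i] acells_bound[of e m] card_Un_le[of "icells i" "acells e m"]
    by (simp add: card_insert_if)
next
  case (Argmin D lo m hi g a i)
  show ?case
    using icells_bound[of i] ocells_bound[of g m] acells_bound[of lo m] acells_bound[of hi m]
      card_Un_le[of "icells i" "ocells g m"]
      card_Un_le[of "icells i \<union> ocells g m" "acells lo m"]
      card_Un_le[of "icells i \<union> ocells g m \<union> acells lo m" "acells hi m"]
    by (simp add: card_insert_if)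
next
  case (Seq c1 m t1 Z1 m1 c2 t2 Z2 m2)
  then show ?case using card_Un_le[of Z1 Z2] by simp
next
  case (CondTrue b m c1 t Z m' c2)
  then show ?case using bcells_bound[of b m] card_Un_le[of "bcells b m" Z] by simp
next
  case (CondFalse b m c2 t Z m' c1)
  then show ?case using bcells_bound[of b m] card_Un_le[of "bcells b m" Z] by simp
next
  case (WhileFalse b m c)
  then show ?case using bcells_bound[of b m] by simp
next
  case (WhileTrue b m c t1 Z1 m1 t2 Z2 m2)
  then show ?case
    using bcells_bound[of b m] card_Un_le[of "bcells b m" Z1] card_Un_le[of "bcells b m \<union> Z1" Z2]
    by simp
qed simp

definition reaches :: "com \<Rightarrow> nat \<Rightarrow> (machine \<Rightarrow> bool) \<Rightarrow> machine \<Rightarrow> bool" where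
  "reaches c T Q m \<longleftrightarrow> (\<exists>t Z m'. run c m t Z m' \<and> t \<le> T \<and> Q m')"

lemma reaches_mono:
  "reaches c T Q m \<Longrightarrow> T \<le> T' \<Longrightarrow> (\<And>m'. Q m' \<Longrightarrow> Q' m') \<Longrightarrow> reaches c T' Q' m"
  unfolding reaches_def by (meson order_trans)

lemma reaches_Seq:
  assumes "reaches c1 T1 P m" and "\<And>m1. P m1 \<Longrightarrow> reaches c2 T2 Q m1"
  shows "reaches (Seq c1 c2) (T1 + T2) Q m"
  using assms unfolding reaches_def by (meson add_mono run.Seq)

text \<open>
  A bound that does not depend on the machine, which is what makes the constant of the theorem
  uniform in the problem data. It is meaningful for loop-free programs only; loops are
  handled by \<open>reaches_For\<close>.
\<close>

primrec straight_cost :: "com \<Rightarrow> nat" where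
  "straight_cost Skip = 0"
| "straight_cost (SetReg r e) = 1 + icost e"
| "straight_cost (Store a i e) = 1 + icost i + acost e"
| "straight_cost (Argmin a i g lo hi) = 1 + icost i + ocost g + acost lo + acost hi"
| "straight_cost (Seq c1 c2) = straight_cost c1 + straight_cost c2"
| "straight_cost (Cond b c1 c2) = 1 + bcost b + max (straight_cost c1) (straight_cost c2)"
| "straight_cost (While b c) = 0"

text \<open>
  A weakest precondition for loop-free programs. A loop gets precondition \<open>False\<close>, so that
  \<open>wp\<close> is sound for all programs. For \<open>Argmin\<close>, continuity is demanded in place of the
  existence of a minimizer, which it implies on a compact interval.
\<close>

primrec wp :: "com \<Rightarrow> (machine \<Rightarrow> bool) \<Rightarrow> machine \<Rightarrow> bool" where
  "wp Skip Q m = Q m"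
| "wp (SetReg r e) Q m = Q (set_reg r (ival e m) m)"
| "wp (Store a i e) Q m = Q (set_mem a (ival i m) (aval e m) m)"
| "wp (Argmin a i g lo hi) Q m =
     (let D = {aval lo m .. aval hi m} in
      D \<noteq> {} \<and> convex_on D (oval g m) \<and> continuous_on D (oval g m) \<and>
      Q (set_mem a (ival i m) (arg_min_on (oval g m) D) m))"
| "wp (Seq c1 c2) Q m = wp c1 (wp c2 Q) m"
| "wp (Cond b c1 c2) Q m = (if bval b m then wp c1 Q m else wp c2 Q m)"
| "wp (While b c) Q m = False"

lemma arg_min_on_interval:
  fixes g :: "real \<Rightarrow> real"
  assumes "continuous_on {l..h} g" and "{l..h} \<noteq> {}"
  shows "is_arg_min g (\<lambda>v. v \<in> {l..h}) (arg_min_on g {l..h})"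
proof -
  obtain v where "is_arg_min g (\<lambda>v. v \<in> {l..h}) v"
    using continuous_attains_inf[OF compact_Icc assms(2,1)]
    unfolding is_arg_min_linorder by blast
  then show ?thesis
    unfolding arg_min_on_def arg_min_def by (rule someI)
qed

lemma reaches_wp: "wp c Q m \<Longrightarrow> reaches c (straight_cost c) Q m"
proof (induction c arbitrary: Q m)
  case (SetReg r e)
  then show ?case
    using run.SetReg[of r e m] unfolding reaches_def straight_cost.simps wp.simps by blast
next
  case (Store a i e)
  then show ?case
    using run.Store[of a i e m] unfolding reaches_def straight_cost.simps wp.simps by blast
next
  case (Argmin a i g lo hi)
  let ?D = "{aval lo m .. aval hi m}"
  have D: "?D \<noteq> {}" "convex_on ?D (oval g m)" "continuous_on ?D (oval g m)"
    and Q: "Q (set_mem a (ival i m) (arg_min_on (oval g m) ?D) m)"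
    using Argmin by (auto simp: Let_def)
  have "\<exists>v. is_arg_min (oval g m) (\<lambda>v. v \<in> ?D) v"
    using arg_min_on_interval[OF D(3,1)] by blast
  from run.Argmin[OF refl D(1,2) this] Q show ?case
    unfolding reaches_def straight_cost.simps by blast
next
  case (Seq c1 c2)
  then have "reaches c1 (straight_cost c1) (wp c2 Q) m" by simp
  then show ?case unfolding straight_cost.simps by (rule reaches_Seq) (rule Seq.IH)
next
  case (Cond b c1 c2)
  show ?case
  proof (cases "bval b m")
    case True
    with Cond obtain t Z m' where c: "run c1 m t Z m'" and t: "t \<le> straight_cost c1" and "Q m'"
      unfolding reaches_def by fastforce
    moreover have "1 + bcost b + t \<le> straight_cost (Cond b c1 c2)" using t by simp
    ultimately show ?thesis
      using run.CondTrue[OF True c] unfolding reaches_def by blast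
  next
    case False
    with Cond obtain t Z m' where c: "run c2 m t Z m'" and t: "t \<le> straight_cost c2" and "Q m'"
      unfolding reaches_def by fastforce
    moreover have "1 + bcost b + t \<le> straight_cost (Cond b c1 c2)" using t by simp
    ultimately show ?thesis
      using run.CondFalse[OF False c] unfolding reaches_def by blast
  qed
qed (auto simp: reaches_def intro: run.intros)

definition For :: "string \<Rightarrow> string \<Rightarrow> com \<Rightarrow> com" where
  "For r n c = Seq (SetReg r (INum 0))
     (While (ILess (Reg r) (Reg n)) (Seq c (SetReg r (IAdd (Reg r) (INum 1)))))"

lemma wp_mono: "wp c Q m \<Longrightarrow> (\<And>m'. Q m' \<Longrightarrow> Q' m') \<Longrightarrow> wp c Q' m"
  by (induction c arbitrary: Q Q' m) (auto simp: Let_def split: if_splits)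

lemma wp_Store:
  "ival i m = j \<Longrightarrow> aval e m = v \<Longrightarrow> Q (set_mem a j v m) \<Longrightarrow> wp (Store a i e) Q m"
  by simp

lemma wp_Cond:
  "(bval b m \<Longrightarrow> wp c1 Q m) \<Longrightarrow> (\<not> bval b m \<Longrightarrow> wp c2 Q m) \<Longrightarrow> wp (Cond b c1 c2) Q m"
  by simp

lemma wp_Argmin:
  assumes "{aval lo m .. aval hi m} = D" "oval g m = f" "D \<noteq> {}" "convex_on D f" "continuous_on D f"
    and "Q (set_mem a (ival i m) (arg_min_on f D) m)"
  shows "wp (Argmin a i g lo hi) Q m"
  using assms by (simp add: Let_def)

lemma reg_simps [simp]:
  "regs (set_reg r n m) = (regs m)(r := n)" "mem (set_reg r n m) = mem m"
  "regs (set_mem a i v m) = regs m"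
  by (auto simp: set_reg_def set_mem_def)

lemma mem_set_mem [simp]:
  "mem (set_mem a i v m) b j = (if b = a \<and> j = i then v else mem m b j)"
  by (auto simp: set_mem_def)

lemma set_mem_twice [simp]: "set_mem a i v (set_mem a i v' m) = set_mem a i v m"
  by (simp add: set_mem_def)

text \<open>
  The invariant is evaluated after the counter has been advanced, hence the updated machine in
  \<open>step\<close>. The body may use the counter's register as long as it restores it.
  Each round pays 2 units for the comparison and 2 for the increment; the loop pays 1 for the
  initialization and 2 for the last comparison.
\<close>

lemma reaches_For:
  assumes rn: "r \<noteq> n" and n: "regs m n = K"
    and init: "I 0 (set_reg r 0 m)"
    and step: "\<And>i m. \<lbrakk>i < K; regs m r = i; regs m n = K; I i m\<rbrakk> \<Longrightarrow>
      reaches c T (\<lambda>m'. regs m' r = i \<and> regs m' n = K \<and> I (Suc i) (set_reg r (Suc i) m')) m"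
  shows "reaches (For r n c) (3 + K * (T + 4)) (I K) m"
proof -
  let ?b = "ILess (Reg r) (Reg n)"
  let ?c = "Seq c (SetReg r (IAdd (Reg r) (INum 1)))"
  have loop: "reaches (While ?b ?c) (2 + j * (T + 4)) (I K) m"
    if "j + regs m r = K" "regs m n = K" "I (regs m r) m" for j m
    using that
  proof (induction j arbitrary: m)
    case 0
    then have "\<not> bval ?b m" by simp
    note run.WhileFalse[OF this, of ?c]
    moreover have "1 + bcost ?b \<le> 2 + 0 * (T + 4)" by simp
    moreover have "I K m" using 0 by simp
    ultimately show ?case unfolding reaches_def by blast
  next
    case (Suc j)
    let ?i = "regs m r"
    from Suc.prems step[of ?i m]
    obtain t Z m1 where run1: "run c m t Z m1" and t: "t \<le> T"
      and m1: "regs m1 r = ?i" "regs m1 n = K" "I (Suc ?i) (set_reg r (Suc ?i) m1)"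
      unfolding reaches_def by auto
    let ?m2 = "set_reg r (Suc ?i) m1"
    have set: "run (SetReg r (IAdd (Reg r) (INum 1))) m1 2 {RegCell r} ?m2"
      using run.SetReg[of r "IAdd (Reg r) (INum 1)" m1] m1 by (simp add: numeral_2_eq_2)
    have "reaches (While ?b ?c) (2 + j * (T + 4)) (I K) ?m2"
      using Suc.prems m1 rn by (intro Suc.IH) auto
    then obtain t' Z' m' where run2: "run (While ?b ?c) ?m2 t' Z' m'"
      and t': "t' \<le> 2 + j * (T + 4)" and "I K m'"
      unfolding reaches_def by auto
    moreover have "bval ?b m" using Suc.prems by simp
    note run.WhileTrue[OF this run.Seq[OF run1 set] run2]
    moreover have "1 + bcost ?b + (t + 2) + t' \<le> 2 + Suc j * (T + 4)"
      using t t' by simp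
    ultimately show ?case unfolding reaches_def by blast
  qed
  have "reaches (For r n c) (straight_cost (SetReg r (INum 0)) + (2 + K * (T + 4))) (I K) m"
    unfolding For_def
  proof (rule reaches_Seq[OF reaches_wp])
    show "wp (SetReg r (INum 0)) (\<lambda>m. regs m r = 0 \<and> regs m n = K \<and> I 0 m) m"
      using rn n init by simp
  qed (use loop[of K] in auto)
  then show ?thesis by (simp add: eval_nat_numeral)
qed

section \<open>Separability of the augmented Lagrangian\<close>

definition in_bounds :: "mpc \<Rightarrow> rmat \<Rightarrow> rmat \<Rightarrow> bool" where
  "in_bounds d u x \<longleftrightarrow>
     (\<forall>s<scen d. \<forall>k<hor d. u k s \<in> U_int d k s \<and> x (Suc k) s \<in> X_int d)"

text \<open>
  The contribution of scenario \<open>s\<close> to the augmented Lagrangian without the indicator functions.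
\<close>

definition smooth_part :: "mpc \<Rightarrow> ux \<Rightarrow> tz \<Rightarrow> mult \<Rightarrow> nat \<Rightarrow> real" where
  "smooth_part d = (\<lambda>(u, x) (\<tau>, \<zeta>) (\<nu>, \<psi>, \<phi>) s.
       (\<Sum>k\<in>eng_on d s. fuel d k s (u k s))
     + rho1 d / 2 * (\<Sum>k<hor d. (u k s - \<zeta> k s + \<nu> k s)\<^sup>2)
     + rho2 d / 2 * (\<Sum>k<hor d. (x (Suc k) s + Psi_mult d \<zeta> k s - x_now d + \<psi> k s)\<^sup>2)
     + rho3 d / 2 * (\<tau> - u 0 s + \<phi> s)\<^sup>2)"

text \<open>
  All indicator values are \<open>0\<close> or \<open>\<infinity>\<close>, so one violated bound makes the whole extended-real
  sum infinite.
\<close>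

lemma lagrangian_eq:
  assumes "scen d \<ge> 1"
  shows "lagrangian d (u, x) z l =
    (if in_bounds d u x then ereal (1 / real (scen d) * (\<Sum>s<scen d. smooth_part d (u, x) z l s))
     else \<infinity>)"
proof -
  obtain \<tau> \<zeta> where z: "z = (\<tau>, \<zeta>)" by (cases z)
  obtain \<nu> \<psi> \<phi> where l: "l = (\<nu>, \<psi>, \<phi>)" by (cases l)
  define pen where "pen s = (\<Sum>k<hor d. ind (U_int d k s) (u k s) + ind (X_int d) (x (Suc k) s))" for s
  have "lagrangian d (u, x) z l =
      ereal (1 / real (scen d)) * (\<Sum>s<scen d. ereal (smooth_part d (u, x) z l s) + pen s)"
    unfolding z l lagrangian.simps pen_def smooth_part_def prod.case
    by (simp add: plus_ereal.simps(1)[symmetric] add_ac del: plus_ereal.simps)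
  also have "\<dots> = (if in_bounds d u x
      then ereal (1 / real (scen d) * (\<Sum>s<scen d. smooth_part d (u, x) z l s)) else \<infinity>)"
  proof (cases "in_bounds d u x")
    case True
    then have "pen s = 0" if "s < scen d" for s
      using that by (simp add: pen_def in_bounds_def ind_def)
    with True show ?thesis by simp
  next
    case False
    then obtain s k where sk: "s < scen d" "k < hor d"
      "ind (U_int d k s) (u k s) + ind (X_int d) (x (Suc k) s) = \<infinity>"
      by (auto simp: in_bounds_def ind_def)
    then have "pen s = \<infinity>"
      unfolding pen_def sum_Pinfty by auto
    with sk have "(\<Sum>s<scen d. ereal (smooth_part d (u, x) z l s) + pen s) = \<infinity>"
      unfolding sum_Pinfty by auto
    with False assms show ?thesis by simp
  qed
  finally show ?thesis .
qed

definition u_obj :: "mpc \<Rightarrow> tz \<Rightarrow> mult \<Rightarrow> nat \<Rightarrow> nat \<Rightarrow> real \<Rightarrow> real" where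
  "u_obj d = (\<lambda>(\<tau>, \<zeta>) (\<nu>, \<psi>, \<phi>) k s v.
       (if k \<in> eng_on d s then fuel d k s v else 0)
     + rho1 d / 2 * (v - \<zeta> k s + \<nu> k s)\<^sup>2
     + (if k = 0 then rho3 d / 2 * (\<tau> - v + \<phi> s)\<^sup>2 else 0))"

definition x_obj :: "mpc \<Rightarrow> tz \<Rightarrow> mult \<Rightarrow> nat \<Rightarrow> nat \<Rightarrow> real \<Rightarrow> real" where
  "x_obj d = (\<lambda>(\<tau>, \<zeta>) (\<nu>, \<psi>, \<phi>) k s v.
     rho2 d / 2 * (v + Psi_mult d \<zeta> k s - x_now d + \<psi> k s)\<^sup>2)"

text \<open>
  The term coupling \<open>\<tau>\<close> and \<open>u\<close> involves row 0 only, which is why \<open>u_obj\<close> treats \<open>k = 0\<close>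
  specially. The matrix \<open>\<Psi>\<close> acts on \<open>\<zeta>\<close>, which is fixed here, and so couples no entries of \<open>x\<close>.
\<close>

lemma smooth_part_separable:
  assumes "valid_mpc d" and "s < scen d"
  shows "smooth_part d (u, x) z l s =
    (\<Sum>k<hor d. u_obj d z l k s (u k s) + x_obj d z l k s (x (Suc k) s))"
proof -
  obtain \<tau> \<zeta> where z: "z = (\<tau>, \<zeta>)" by (cases z)
  obtain \<nu> \<psi> \<phi> where l: "l = (\<nu>, \<psi>, \<phi>)" by (cases l)
  have N: "0 < hor d" "eng_on d s \<subseteq> {..<hor d}"
    using assms by (auto simp: valid_mpc_def)
  have "(\<Sum>k<hor d. if k \<in> eng_on d s then fuel d k s (u k s) else 0) =
      (\<Sum>k\<in>eng_on d s. fuel d k s (u k s))"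
    using N by (simp add: sum.If_cases Int_absorb1)
  then show ?thesis
    using N by (simp add: z l smooth_part_def u_obj_def x_obj_def sum.distrib sum_distrib_left)
qed

section \<open>The update of \<open>(u, x)\<close>\<close>

lemma convex_on_square: "convex_on D (\<lambda>v::real. (c * v + b)\<^sup>2)" if "convex D"
proof (rule convex_onI)
  fix t x y :: real
  assume t: "0 < t" "t < 1"
  have "(1 - t) * (c * x + b)\<^sup>2 + t * (c * y + b)\<^sup>2 - (c * ((1 - t) * x + t * y) + b)\<^sup>2
      = t * (1 - t) * (c * (x - y))\<^sup>2"
    by (simp add: power2_eq_square algebra_simps)
  then show "(c * ((1 - t) *\<^sub>R x + t *\<^sub>R y) + b)\<^sup>2 \<le> (1 - t) * (c * x + b)\<^sup>2 + t * (c * y + b)\<^sup>2"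
    using t by (simp add: le_diff_eq[symmetric] zero_le_mult_iff) (smt (verit) mult_nonneg_nonneg zero_le_power2)
qed (fact that)

lemma convex_on_scaled_square:
  fixes f :: "real \<Rightarrow> real"
  assumes "r \<ge> 0" "convex D" and f: "\<And>v. f v = r / 2 * (c * v + b)\<^sup>2"
  shows "convex_on D f"
  unfolding f[abs_def] using assms by (intro convex_on_cmul convex_on_square) auto

lemma u_obj_convex:
  assumes "valid_mpc d" "s < scen d" "k < hor d"
  shows "convex_on (U_int d k s) (u_obj d z l k s)"
proof -
  obtain \<tau> \<zeta> where z: "z = (\<tau>, \<zeta>)" by (cases z)
  obtain \<nu> \<psi> \<phi> where l: "l = (\<nu>, \<psi>, \<phi>)" by (cases l)
  have D: "convex (U_int d k s)" by (simp add: U_int_def)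
  have rho: "rho1 d \<ge> 0" "rho3 d \<ge> 0" using assms by (auto simp: valid_mpc_def)
  have f: "convex_on (U_int d k s) (\<lambda>v. if k \<in> eng_on d s then fuel d k s v else 0)"
    using assms D by (cases "k \<in> eng_on d s") (auto simp: valid_mpc_def convex_on_const)
  have a: "convex_on (U_int d k s) (\<lambda>v. rho1 d / 2 * (v - \<zeta> k s + \<nu> k s)\<^sup>2)"
    by (rule convex_on_scaled_square[OF rho(1) D, where c = 1 and b = "\<nu> k s - \<zeta> k s"])
      (simp add: algebra_simps)
  have "convex_on (U_int d k s) (\<lambda>v. rho3 d / 2 * (\<tau> - v + \<phi> s)\<^sup>2)"
    by (rule convex_on_scaled_square[OF rho(2) D, where c = "- 1" and b = "\<tau> + \<phi> s"])
      (simp add: algebra_simps)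
  then have b: "convex_on (U_int d k s) (\<lambda>v. if k = 0 then rho3 d / 2 * (\<tau> - v + \<phi> s)\<^sup>2 else 0)"
    using D by (cases "k = 0") (auto simp: convex_on_const)
  show ?thesis
    using convex_on_add[OF convex_on_add[OF f a] b]
    by (simp add: u_obj_def z l)
qed

lemma u_obj_continuous:
  assumes "valid_mpc d" "s < scen d" "k < hor d"
  shows "continuous_on (U_int d k s) (u_obj d z l k s)"
proof -
  obtain \<tau> \<zeta> where z: "z = (\<tau>, \<zeta>)" by (cases z)
  obtain \<nu> \<psi> \<phi> where l: "l = (\<nu>, \<psi>, \<phi>)" by (cases l)
  have "continuous_on (U_int d k s) (\<lambda>v. if k \<in> eng_on d s then fuel d k s v else 0)"
  proof (cases "k \<in> eng_on d s")
    case True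
    then have "beta2 d k s \<noteq> 0" "volt d k \<noteq> 0"
      using assms by (force simp: valid_mpc_def)+
    with True show ?thesis
      unfolding fuel_def fuel_quad_def g_inv_def g_inv_radicand_def
      by (simp, intro continuous_intros) auto
  qed simp
  moreover have "continuous_on (U_int d k s) (\<lambda>v. rho1 d / 2 * (v - \<zeta> k s + \<nu> k s)\<^sup>2)"
    by (intro continuous_intros)
  moreover have "continuous_on (U_int d k s) (\<lambda>v. if k = 0 then rho3 d / 2 * (\<tau> - v + \<phi> s)\<^sup>2 else 0)"
    by (cases "k = 0") (auto intro!: continuous_intros)
  ultimately show ?thesis
    unfolding u_obj_def z l prod.case by (intro continuous_on_add)
qed

lemma x_obj_convex:
  assumes "valid_mpc d"
  shows "convex_on (X_int d) (x_obj d z l k s)"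
proof -
  obtain \<tau> \<zeta> where z: "z = (\<tau>, \<zeta>)" by (cases z)
  obtain \<nu> \<psi> \<phi> where l: "l = (\<nu>, \<psi>, \<phi>)" by (cases l)
  have D: "convex (X_int d)" by (simp add: X_int_def)
  show ?thesis
    using assms D
    by (intro convex_on_scaled_square[where r = "rho2 d" and c = 1
          and b = "Psi_mult d \<zeta> k s - x_now d + \<psi> k s"])
      (simp_all add: valid_mpc_def x_obj_def z l algebra_simps)
qed

lemma x_obj_continuous: "continuous_on (X_int d) (x_obj d z l k s)"
  unfolding x_obj_def by (cases z, cases l) (auto intro!: continuous_intros)

definition u_new :: "mpc \<Rightarrow> tz \<Rightarrow> mult \<Rightarrow> rmat" where
  "u_new d z l k s = arg_min_on (u_obj d z l k s) (U_int d k s)"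

text \<open>
  Rows of \<open>x\<close> are numbered from 1, so row \<open>k\<close> of \<open>x\<close> belongs to the objective with index \<open>k - 1\<close>.
\<close>

definition x_new :: "mpc \<Rightarrow> tz \<Rightarrow> mult \<Rightarrow> rmat" where
  "x_new d z l k s = arg_min_on (x_obj d z l (k - 1) s) (X_int d)"

lemma u_new_arg_min:
  assumes "valid_mpc d" "s < scen d" "k < hor d"
  shows "is_arg_min (u_obj d z l k s) (\<lambda>v. v \<in> U_int d k s) (u_new d z l k s)"
  unfolding u_new_def U_int_def
  using u_obj_continuous[OF assms, unfolded U_int_def] assms
  by (intro arg_min_on_interval) (auto simp: valid_mpc_def)

lemma x_new_arg_min:
  assumes "valid_mpc d"
  shows "is_arg_min (x_obj d z l k s) (\<lambda>v. v \<in> X_int d) (x_new d z l (Suc k) s)"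
  unfolding x_new_def X_int_def diff_Suc_1
  using x_obj_continuous[of d, unfolded X_int_def] assms
  by (intro arg_min_on_interval) (auto simp: valid_mpc_def)

lemma new_in_bounds: "valid_mpc d \<Longrightarrow> in_bounds d (u_new d z l) (x_new d z l)"
  using u_new_arg_min x_new_arg_min by (auto simp: in_bounds_def is_arg_min_def)

lemma lagrangian_arg_min_ux:
  assumes "valid_mpc d"
  shows "is_arg_min (\<lambda>ut. lagrangian d ut z l) (\<lambda>_. True) (u_new d z l, x_new d z l)"
proof -
  have S: "scen d \<ge> 1" using assms by (simp add: valid_mpc_def)
  have "lagrangian d (u_new d z l, x_new d z l) z l \<le> lagrangian d (u, x) z l" for u x
  proof (cases "in_bounds d u x")
    case True
    have "smooth_part d (u_new d z l, x_new d z l) z l s \<le> smooth_part d (u, x) z l s"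
      if s: "s < scen d" for s
      unfolding smooth_part_separable[OF assms s]
      using u_new_arg_min[OF assms s, of _ z l] x_new_arg_min[OF assms, of z l _ s] True s
      by (intro sum_mono add_mono) (auto simp: in_bounds_def is_arg_min_linorder)
    then have "1 / real (scen d) * (\<Sum>s<scen d. smooth_part d (u_new d z l, x_new d z l) z l s)
        \<le> 1 / real (scen d) * (\<Sum>s<scen d. smooth_part d (u, x) z l s)"
      by (intro mult_left_mono sum_mono) auto
    then show ?thesis
      using True new_in_bounds[OF assms, of z l] by (simp only: lagrangian_eq[OF S] if_True ereal_less_eq)
  qed (simp add: lagrangian_eq[OF S])
  then show ?thesis by (auto simp: is_arg_min_linorder)
qed

section \<open>The update of \<open>(\<tau>, \<zeta>)\<close>\<close>

lemma Psi_mult_prefix: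
  assumes "k < hor d"
  shows "Psi_mult d w k s = (\<Sum>j<Suc k. w j s)"
proof -
  have "{..<hor d} \<inter> {j. j \<le> k} = {..<Suc k}" using assms by auto
  moreover have "Psi_mult d w k s = (\<Sum>j<hor d. if j \<le> k then w j s else 0)"
    unfolding Psi_mult_def Psi_def by (intro sum.cong) auto
  ultimately show ?thesis by (simp add: sum.If_cases del: sum.lessThan_Suc)
qed

lemma mean_minimizes_squares:
  fixes c :: "nat \<Rightarrow> real"
  assumes "n > 0"
  shows "(\<Sum>s<n. ((\<Sum>i<n. c i) / real n - c s)\<^sup>2) \<le> (\<Sum>s<n. (t - c s)\<^sup>2)"
proof -
  define \<mu> where "\<mu> = (\<Sum>i<n. c i) / real n"
  have "(\<Sum>s<n. (t - c s)\<^sup>2) = (\<Sum>s<n. (\<mu> - c s)\<^sup>2 + (t - \<mu>)\<^sup>2 + 2 * (t - \<mu>) * (\<mu> - c s))"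
    by (intro sum.cong) (auto simp: power2_eq_square algebra_simps)
  also have "\<dots> = (\<Sum>s<n. (\<mu> - c s)\<^sup>2) + real n * (t - \<mu>)\<^sup>2"
    using assms by (simp add: sum.distrib sum_distrib_left[symmetric] sum_subtractf \<mu>_def)
  finally show ?thesis by (simp add: \<mu>_def)
qed

text \<open>
  The hypothesis says that the gradient vanishes: \<open>\<Sum>j=k..<n\<close> is the action of \<open>\<Psi>\<^sup>T\<close> on the
  residual of the prefix sums. The objective is convex and quadratic, so its value at \<open>\<xi>\<close> exceeds
  its value at \<open>\<zeta>\<close> by a nonnegative quadratic form in \<open>\<delta> = \<xi> - \<zeta>\<close>; the cross term is the inner product of
  the gradient with \<open>\<delta>\<close>.
\<close>

lemma prefix_least_squares_optimal:
  fixes a b \<zeta> \<xi> :: "nat \<Rightarrow> real"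
  assumes r: "r1 \<ge> 0" "r2 \<ge> 0"
    and stationary: "\<And>k. k < n \<Longrightarrow>
      r1 * (\<zeta> k - a k) + r2 * (\<Sum>j=k..<n. (\<Sum>i<Suc j. \<zeta> i) - b j) = 0"
  shows "r1 / 2 * (\<Sum>k<n. (\<zeta> k - a k)\<^sup>2) + r2 / 2 * (\<Sum>k<n. ((\<Sum>i<Suc k. \<zeta> i) - b k)\<^sup>2)
       \<le> r1 / 2 * (\<Sum>k<n. (\<xi> k - a k)\<^sup>2) + r2 / 2 * (\<Sum>k<n. ((\<Sum>i<Suc k. \<xi> i) - b k)\<^sup>2)"
proof -
  define \<delta> where "\<delta> k = \<xi> k - \<zeta> k" for k
  define e where "e k = (\<Sum>i<Suc k. \<zeta> i) - b k" for k
  have \<xi>: "\<xi> k = \<zeta> k + \<delta> k" for k by (simp add: \<delta>_def)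
  have square: "(v + w)\<^sup>2 = v\<^sup>2 + w\<^sup>2 + 2 * (w * v)" for v w :: real
    by (simp add: power2_eq_square algebra_simps)
  have 1: "(\<Sum>k<n. (\<xi> k - a k)\<^sup>2) =
      (\<Sum>k<n. (\<zeta> k - a k)\<^sup>2) + (\<Sum>k<n. (\<delta> k)\<^sup>2) + 2 * (\<Sum>k<n. \<delta> k * (\<zeta> k - a k))"
  proof -
    have "\<xi> k - a k = (\<zeta> k - a k) + \<delta> k" for k
      unfolding \<xi> by simp
    then show ?thesis
      by (simp only: square sum.distrib sum_distrib_left)
  qed
  have 2: "(\<Sum>k<n. ((\<Sum>i<Suc k. \<xi> i) - b k)\<^sup>2) =
      (\<Sum>k<n. (e k)\<^sup>2) + (\<Sum>k<n. (\<Sum>i<Suc k. \<delta> i)\<^sup>2) + 2 * (\<Sum>k<n. (\<Sum>i<Suc k. \<delta> i) * e k)"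
  proof -
    have "(\<Sum>i<Suc k. \<xi> i) - b k = e k + (\<Sum>i<Suc k. \<delta> i)" for k
      unfolding e_def \<xi> sum.distrib by simp
    then show ?thesis
      by (simp only: square sum.distrib sum_distrib_left)
  qed
  have "(\<Sum>k<n. (\<Sum>i<Suc k. \<delta> i) * e k) = (\<Sum>k<n. \<Sum>i<n. if i \<le> k then \<delta> i * e k else 0)"
  proof (intro sum.cong refl)
    fix k assume "k \<in> {..<n}"
    then have "{..<n} \<inter> {i. i \<le> k} = {..<Suc k}" by auto
    then show "(\<Sum>i<Suc k. \<delta> i) * e k = (\<Sum>i<n. if i \<le> k then \<delta> i * e k else 0)"
      by (simp add: sum.If_cases sum_distrib_right del: sum.lessThan_Suc)
  qed
  also have "\<dots> = (\<Sum>i<n. \<Sum>k<n. if i \<le> k then \<delta> i * e k else 0)"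
    by (rule sum.swap)
  also have "\<dots> = (\<Sum>i<n. \<delta> i * (\<Sum>k=i..<n. e k))"
  proof (intro sum.cong refl)
    fix i
    have "{..<n} \<inter> {k. i \<le> k} = {i..<n}" by auto
    then show "(\<Sum>k<n. if i \<le> k then \<delta> i * e k else 0) = \<delta> i * (\<Sum>k=i..<n. e k)"
      by (simp add: sum.If_cases sum_distrib_left)
  qed
  finally have swap: "(\<Sum>k<n. (\<Sum>i<Suc k. \<delta> i) * e k) = (\<Sum>k<n. \<delta> k * (\<Sum>j=k..<n. e j))" .
  have "r1 * (\<Sum>k<n. \<delta> k * (\<zeta> k - a k)) + r2 * (\<Sum>k<n. (\<Sum>i<Suc k. \<delta> i) * e k)
      = (\<Sum>k<n. \<delta> k * (r1 * (\<zeta> k - a k) + r2 * (\<Sum>j=k..<n. e j)))"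
    unfolding swap sum_distrib_left[of r1] sum_distrib_left[of r2] sum.distrib[symmetric]
    by (intro sum.cong refl) (simp add: algebra_simps flip: sum_distrib_left)
  also have "\<dots> = 0"
    using stationary by (intro sum.neutral) (simp add: e_def del: sum.lessThan_Suc)
  finally have cross: "r1 * (\<Sum>k<n. \<delta> k * (\<zeta> k - a k)) + r2 * (\<Sum>k<n. (\<Sum>i<Suc k. \<delta> i) * e k) = 0" .
  have "0 \<le> r1 / 2 * (\<Sum>k<n. (\<delta> k)\<^sup>2) + r2 / 2 * (\<Sum>k<n. (\<Sum>i<Suc k. \<delta> i)\<^sup>2)"
    using r by (intro add_nonneg_nonneg mult_nonneg_nonneg sum_nonneg) auto
  then show ?thesis
    using cross unfolding 1 2 e_def[symmetric] by (simp add: algebra_simps del: sum.lessThan_Suc)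
qed

text \<open>
  The backward Riccati recursion, in the number \<open>i\<close> of steps that remain; the row that
  \<open>offset\<close> treats in step \<open>Suc i\<close> is \<open>n - Suc i\<close>. Here \<open>c = \<rho>\<^sub>2 / \<rho>\<^sub>1\<close>.
  It results from eliminating \<open>y\<^sub>k\<close> and \<open>q\<^sub>k\<^sub>+\<^sub>1\<close> from
  \<open>q\<^sub>k = y\<^sub>k - b\<^sub>k + q\<^sub>k\<^sub>+\<^sub>1\<close>, \<open>y\<^sub>k = y\<^sub>k\<^sub>-\<^sub>1 + a\<^sub>k - c q\<^sub>k\<close> and the affine formula for \<open>q\<^sub>k\<^sub>+\<^sub>1\<close> in \<open>y\<^sub>k\<close>.
\<close>

primrec gain :: "real \<Rightarrow> nat \<Rightarrow> real" where
  "gain c 0 = 0"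
| "gain c (Suc i) = (1 + gain c i) / (1 + c * (1 + gain c i))"

primrec offset :: "nat \<Rightarrow> real \<Rightarrow> (nat \<Rightarrow> real) \<Rightarrow> (nat \<Rightarrow> real) \<Rightarrow> nat \<Rightarrow> real" where
  "offset n c a b 0 = 0"
| "offset n c a b (Suc i) =
     ((1 + gain c i) * a (n - Suc i) + offset n c a b i - b (n - Suc i)) / (1 + c * (1 + gain c i))"

text \<open>
  \<open>level n c a b k\<close> is the sum of the optimal \<open>\<zeta>\<^sub>j\<close> over \<open>j < k\<close>; the increment is \<open>a\<^sub>k - c q\<^sub>k\<close>, as
  stationarity requires.
\<close>

primrec level :: "nat \<Rightarrow> real \<Rightarrow> (nat \<Rightarrow> real) \<Rightarrow> (nat \<Rightarrow> real) \<Rightarrow> nat \<Rightarrow> real" where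
  "level n c a b 0 = 0"
| "level n c a b (Suc k) = level n c a b k +
     (a k - c * (gain c (n - k) * level n c a b k + offset n c a b (n - k)))"

text \<open>
  Nonnegative gains keep the denominators of the recursion at least 1.
\<close>

lemma gain_nonneg: "c \<ge> 0 \<Longrightarrow> gain c i \<ge> 0"
  by (induction i) auto

text \<open>
  With no rows to go the costate is 0. One row earlier it grows by \<open>y - b\<close> of that row, where \<open>y\<close>
  depends on the costate itself; the recursion of \<open>gain\<close> and \<open>offset\<close> solves this linear equation.
\<close>

lemma costate_affine:
  assumes "c \<ge> 0" and "i \<le> n"
  shows "(\<Sum>j=n-i..<n. level n c a b (Suc j) - b j) =
    gain c i * level n c a b (n - i) + offset n c a b i"
  using \<open>i \<le> n\<close>
proof (induction i)
  case (Suc i)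
  define k where "k = n - Suc i"
  have k: "n - i = Suc k" "n - k = Suc i" "k < n" using Suc.prems by (auto simp: k_def)
  let ?y = "level n c a b"
  let ?g = "gain c i" and ?h = "offset n c a b i"
  define q where "q = gain c (Suc i) * ?y k + offset n c a b (Suc i)"
  define D where "D = 1 + c * (1 + ?g)"
  have D: "D > 0"
    unfolding D_def using assms(1) gain_nonneg[of c i] by (intro add_pos_nonneg) auto
  have "q = (1 + ?g) / D * ?y k + ((1 + ?g) * a k + ?h - b k) / D"
    by (simp only: q_def D_def k_def gain.simps offset.simps)
  also have "\<dots> = ((1 + ?g) * ?y k + ((1 + ?g) * a k + ?h - b k)) / D"
    by (simp only: add_divide_distrib[symmetric] times_divide_eq_left)
  finally have "q * D = (1 + ?g) * ?y k + ((1 + ?g) * a k + ?h - b k)"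
    using D by simp
  then have q: "q + c * q * (1 + ?g) = (1 + ?g) * (?y k + a k) + ?h - b k"
    by (simp add: D_def algebra_simps)
  have y: "?y (Suc k) = ?y k + (a k - c * q)"
    by (simp only: level.simps k q_def)
  have "(\<Sum>j=k..<n. ?y (Suc j) - b j) = ?y (Suc k) - b k + (\<Sum>j=Suc k..<n. ?y (Suc j) - b j)"
    using k by (simp add: sum.atLeast_Suc_lessThan del: level.simps)
  also have "\<dots> = (1 + ?g) * ?y (Suc k) + ?h - b k"
    using Suc k by (simp add: algebra_simps del: level.simps)
  also have "\<dots> = q"
    using q unfolding y by (simp add: algebra_simps)
  finally show ?case by (simp only: q_def k_def[symmetric])
qed simp

lemma level_stationary:
  fixes a b :: "nat \<Rightarrow> real"
  assumes "r1 > 0" "r2 > 0" and "k < n"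
  defines "c \<equiv> r2 / r1"
  defines "\<zeta> \<equiv> \<lambda>k. level n c a b (Suc k) - level n c a b k"
  shows "r1 * (\<zeta> k - a k) + r2 * (\<Sum>j=k..<n. (\<Sum>i<Suc j. \<zeta> i) - b j) = 0"
proof -
  have prefix: "(\<Sum>i<m. \<zeta> i) = level n c a b m" for m
    by (induction m) (auto simp: \<zeta>_def)
  have "(\<Sum>j=k..<n. (\<Sum>i<Suc j. \<zeta> i) - b j) =
      gain c (n - k) * level n c a b k + offset n c a b (n - k)"
    using costate_affine[of c "n - k" n a b] assms(1-3)
    unfolding prefix by (simp add: c_def del: level.simps)
  then show ?thesis
    using assms by (simp add: \<zeta>_def c_def del: sum.lessThan_Suc)
qed

text \<open>
  The vectors \<open>a\<close> and \<open>b\<close> of the least-squares problem for column \<open>s\<close>.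
\<close>

definition zeta_target :: "rmat \<Rightarrow> rmat \<Rightarrow> nat \<Rightarrow> nat \<Rightarrow> real" where
  "zeta_target u \<nu> s = (\<lambda>k. u k s + \<nu> k s)"

definition level_target :: "mpc \<Rightarrow> rmat \<Rightarrow> rmat \<Rightarrow> nat \<Rightarrow> nat \<Rightarrow> real" where
  "level_target d x \<psi> s = (\<lambda>k. x_now d - x (Suc k) s - \<psi> k s)"

definition opt_level :: "mpc \<Rightarrow> ux \<Rightarrow> mult \<Rightarrow> nat \<Rightarrow> nat \<Rightarrow> real" where
  "opt_level d = (\<lambda>(u, x) (\<nu>, \<psi>, \<phi>) s.
     level (hor d) (rho2 d / rho1 d) (zeta_target u \<nu> s) (level_target d x \<psi> s))"

definition zeta_new :: "mpc \<Rightarrow> ux \<Rightarrow> mult \<Rightarrow> rmat" where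
  "zeta_new d ut l k s = opt_level d ut l s (Suc k) - opt_level d ut l s k"

definition tau_new :: "mpc \<Rightarrow> ux \<Rightarrow> mult \<Rightarrow> real" where
  "tau_new d = (\<lambda>(u, x) (\<nu>, \<psi>, \<phi>). (\<Sum>s<scen d. u 0 s - \<phi> s) / real (scen d))"

lemma zeta_new_prefix: "(\<Sum>k<n. zeta_new d ut l k s) = opt_level d ut l s n"
proof (induction n)
  case 0
  show ?case by (cases ut; cases l) (simp add: opt_level_def)
qed (simp add: zeta_new_def)

text \<open>
  The assumption on the bounds keeps the Lagrangian finite, so that it can be compared term by term;
  it holds after the update of \<open>(u, x)\<close> by \<open>new_in_bounds\<close>.
\<close>

lemma lagrangian_arg_min_tz:
  assumes valid: "valid_mpc d" and bounds: "in_bounds d u x"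
  shows "is_arg_min (\<lambda>z. lagrangian d (u, x) z l) (\<lambda>_. True)
    (tau_new d (u, x) l, zeta_new d (u, x) l)"
proof -
  obtain \<nu> \<psi> \<phi> where l: "l = (\<nu>, \<psi>, \<phi>)" by (cases l)
  have S: "scen d \<ge> 1" and rho: "rho1 d > 0" "rho2 d > 0" "rho3 d > 0"
    using valid by (auto simp: valid_mpc_def)
  let ?t = "tau_new d (u, x) l" and ?z = "zeta_new d (u, x) l"
  define J where "J \<xi> s = rho1 d / 2 * (\<Sum>k<hor d. (\<xi> k s - zeta_target u \<nu> s k)\<^sup>2)
     + rho2 d / 2 * (\<Sum>k<hor d. ((\<Sum>i<Suc k. \<xi> i s) - level_target d x \<psi> s k)\<^sup>2)" for \<xi> s
  have part: "smooth_part d (u, x) (t, \<xi>) l s =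
      (\<Sum>k\<in>eng_on d s. fuel d k s (u k s)) + J \<xi> s + rho3 d / 2 * (t - (u 0 s - \<phi> s))\<^sup>2" for t \<xi> s
  proof -
    have "(\<Sum>k<hor d. (u k s - \<xi> k s + \<nu> k s)\<^sup>2) = (\<Sum>k<hor d. (\<xi> k s - zeta_target u \<nu> s k)\<^sup>2)"
      by (intro sum.cong refl) (simp add: zeta_target_def power2_eq_square algebra_simps)
    moreover have "(\<Sum>k<hor d. (x (Suc k) s + Psi_mult d \<xi> k s - x_now d + \<psi> k s)\<^sup>2) =
        (\<Sum>k<hor d. ((\<Sum>i<Suc k. \<xi> i s) - level_target d x \<psi> s k)\<^sup>2)"
    proof (intro sum.cong refl arg_cong[where f = "\<lambda>v. v\<^sup>2"])
      fix k assume "k \<in> {..<hor d}"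
      then show "x (Suc k) s + Psi_mult d \<xi> k s - x_now d + \<psi> k s =
          (\<Sum>i<Suc k. \<xi> i s) - level_target d x \<psi> s k"
        by (simp add: Psi_mult_prefix level_target_def del: sum.lessThan_Suc)
    qed
    ultimately show ?thesis
      by (simp add: smooth_part_def l J_def algebra_simps)
  qed
  have "J ?z s \<le> J \<xi> s" for \<xi> s
    unfolding J_def
  proof (rule prefix_least_squares_optimal)
    fix k assume "k < hor d"
    from level_stationary[OF rho(1,2) this, of "zeta_target u \<nu> s" "level_target d x \<psi> s"]
    show "rho1 d * (?z k s - zeta_target u \<nu> s k) +
        rho2 d * (\<Sum>j=k..<hor d. (\<Sum>i<Suc j. ?z i s) - level_target d x \<psi> s j) = 0"
      by (simp add: zeta_new_def opt_level_def l del: sum.lessThan_Suc level.simps)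
  qed (use rho in auto)
  moreover have "rho3 d / 2 * (\<Sum>s<scen d. (?t - (u 0 s - \<phi> s))\<^sup>2)
      \<le> rho3 d / 2 * (\<Sum>s<scen d. (t - (u 0 s - \<phi> s))\<^sup>2)" for t
    using mean_minimizes_squares[of "scen d" "\<lambda>s. u 0 s - \<phi> s" t] S rho
    by (intro mult_left_mono) (auto simp: tau_new_def l)
  ultimately have "(\<Sum>s<scen d. smooth_part d (u, x) (?t, ?z) l s)
      \<le> (\<Sum>s<scen d. smooth_part d (u, x) (t, \<xi>) l s)" for t \<xi>
    unfolding part sum.distrib sum_distrib_left[symmetric] by (intro add_mono sum_mono) auto
  then have "1 / real (scen d) * (\<Sum>s<scen d. smooth_part d (u, x) (?t, ?z) l s)
      \<le> 1 / real (scen d) * (\<Sum>s<scen d. smooth_part d (u, x) (t, \<xi>) l s)" for t \<xi>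
    by (intro mult_left_mono) auto
  then have "lagrangian d (u, x) (?t, ?z) l \<le> lagrangian d (u, x) (t, \<xi>) l" for t \<xi>
    using bounds by (simp only: lagrangian_eq[OF S] if_True ereal_less_eq)
  then show ?thesis by (auto simp: is_arg_min_linorder)
qed

section \<open>The program\<close>

abbreviation Add_exp (infixl "+\<^sub>a" 65) where "e +\<^sub>a f \<equiv> AOp Add e f"
abbreviation Sub_exp (infixl "-\<^sub>a" 65) where "e -\<^sub>a f \<equiv> AOp Sub e f"
abbreviation Mul_exp (infixl "*\<^sub>a" 70) where "e *\<^sub>a f \<equiv> AOp Mul e f"
abbreviation Div_exp (infixl "'/\<^sub>a" 70) where "e /\<^sub>a f \<equiv> AOp Div e f"
abbreviation Add_obj (infixl "+\<^sub>o" 65) where "e +\<^sub>o f \<equiv> OOp Add e f"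
abbreviation Sub_obj (infixl "-\<^sub>o" 65) where "e -\<^sub>o f \<equiv> OOp Sub e f"
abbreviation Mul_obj (infixl "*\<^sub>o" 70) where "e *\<^sub>o f \<equiv> OOp Mul e f"
abbreviation Div_obj (infixl "'/\<^sub>o" 70) where "e /\<^sub>o f \<equiv> OOp Div e f"
abbreviation Seq_com (infixr ";;" 60) where "c1 ;; c2 \<equiv> Seq c1 c2"

abbreviation num :: "string \<Rightarrow> aexp" where "num a \<equiv> Get a (INum 0)"
abbreviation set_num :: "string \<Rightarrow> aexp \<Rightarrow> com" where "set_num a e \<equiv> Store a (INum 0) e"

text \<open>
  Positions in a column-wise stored matrix: row \<open>k\<close> and row 0 of column \<open>s\<close>, and row \<open>N - (k + 1)\<close>,
  which the backward recursion visits in step \<open>k\<close>.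
\<close>

definition at_k :: iexp where
  "at_k = IAdd (IMul (Reg ''s'') (Reg ''N'')) (Reg ''k'')"

definition at_0 :: iexp where
  "at_0 = IMul (Reg ''s'') (Reg ''N'')"

definition at_back :: iexp where
  "at_back = IAdd (IMul (Reg ''s'') (Reg ''N'')) (ISub (Reg ''N'') (IAdd (Reg ''k'') (INum 1)))"

abbreviation cur :: "string \<Rightarrow> aexp" where "cur a \<equiv> Get a at_k"
abbreviation sqr :: "oexp \<Rightarrow> oexp" where "sqr e \<equiv> e *\<^sub>o e"

definition radicand_exp :: oexp where
  "radicand_exp =
     Par (Const 0 -\<^sub>a Get ''resist'' (Reg ''k'')) *\<^sub>o sqr DVar
         /\<^sub>o Par (cur ''beta2'' *\<^sub>a (Get ''volt'' (Reg ''k'') *\<^sub>a Get ''volt'' (Reg ''k'')))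
     +\<^sub>o (DVar -\<^sub>o Par (cur ''beta0'')) /\<^sub>o Par (cur ''beta2'')
     +\<^sub>o Par (cur ''beta1'' *\<^sub>a cur ''beta1'' /\<^sub>a (Const 4 *\<^sub>a (cur ''beta2'' *\<^sub>a cur ''beta2'')))"

definition engine_exp :: oexp where
  "engine_exp = Par (cur ''p_out'')
     -\<^sub>o (Par ((Const 0 -\<^sub>a cur ''beta1'') /\<^sub>a (Const 2 *\<^sub>a cur ''beta2'')) +\<^sub>o Sqrt radicand_exp)"

text \<open>
  The objective for rows \<open>k > 0\<close>; \<open>u0_obj_exp\<close> is the one for row 0.
\<close>

definition u_obj_exp :: oexp where
  "u_obj_exp =
     (Par (cur ''fq2'') *\<^sub>o sqr engine_exp +\<^sub>o Par (cur ''fq1'') *\<^sub>o engine_exp +\<^sub>o Par (cur ''fq0''))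
     +\<^sub>o Par (num ''rho1'' /\<^sub>a Const 2)
         *\<^sub>o sqr (DVar -\<^sub>o Par (cur ''zeta'') +\<^sub>o Par (cur ''nu''))"

definition u0_obj_exp :: oexp where
  "u0_obj_exp = u_obj_exp
     +\<^sub>o Par (num ''rho3'' /\<^sub>a Const 2)
         *\<^sub>o sqr (Par (num ''tau'') -\<^sub>o DVar +\<^sub>o Par (Get ''phi'' (Reg ''s'')))"

definition x_obj_exp :: oexp where
  "x_obj_exp = Par (num ''rho2'' /\<^sub>a Const 2)
     *\<^sub>o sqr (DVar +\<^sub>o Par (num ''level'') -\<^sub>o Par (num ''x_now'') +\<^sub>o Par (cur ''psi''))"

text \<open>
  The cell \<open>level\<close> accumulates a column of the old \<open>\<zeta>\<close> and thus supplies the entries of \<open>\<Psi>\<zeta>\<close>.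
  With the engine off, the interval for \<open>u\<close> is a single point.
\<close>

definition ux_step :: com where
  "ux_step =
     set_num ''level'' (num ''level'' +\<^sub>a cur ''zeta'') ;;
     Argmin ''x'' at_k x_obj_exp (num ''x_lo'') (num ''x_hi'') ;;
     Cond (ALess (Const 0) (cur ''eng_on''))
       (Cond (ILess (INum 0) (Reg ''k''))
         (Argmin ''u'' at_k u_obj_exp (cur ''u_lo'') (cur ''u_hi''))
         (Argmin ''u'' at_k u0_obj_exp (cur ''u_lo'') (cur ''u_hi'')))
       (Store ''u'' at_k (cur ''u_lo''))"

text \<open>
  Reals cannot be made from index registers, so the number of scenarios by which the mean is divided
  is counted in a real cell.
\<close>

definition ux_end :: com where
  "ux_end =
     set_num ''sum'' (num ''sum'' +\<^sub>a (Get ''u'' at_0 -\<^sub>a Get ''phi'' (Reg ''s''))) ;;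
     set_num ''count'' (num ''count'' +\<^sub>a Const 1)"

text \<open>
  The old \<open>\<tau>\<close> is kept for the residual \<open>s\<close>.
\<close>

definition ux_pass :: com where
  "ux_pass =
     (set_num ''sum'' (Const 0) ;; set_num ''count'' (Const 0)) ;;
     For ''s'' ''S'' (set_num ''level'' (Const 0) ;; For ''k'' ''N'' ux_step ;; ux_end) ;;
     (set_num ''tau_old'' (num ''tau'') ;; set_num ''tau'' (num ''sum'' /\<^sub>a num ''count''))"

definition riccati_init :: com where
  "riccati_init = Store ''gain'' (INum 0) (Const 0) ;; Store ''offset'' (INum 0) (Const 0)"

text \<open>
  The arrays \<open>gain\<close> and \<open>offset\<close> are indexed by the number of remaining rows, have length \<open>N + 1\<close>,
  and are reused for every column.
\<close>

definition riccati_step :: com where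
  "riccati_step =
     set_num ''slope'' (Const 1 +\<^sub>a Get ''gain'' (Reg ''k'')) ;;
     set_num ''den'' (Const 1 +\<^sub>a num ''rho2'' /\<^sub>a num ''rho1'' *\<^sub>a num ''slope'') ;;
     Store ''gain'' (IAdd (Reg ''k'') (INum 1)) (num ''slope'' /\<^sub>a num ''den'') ;;
     Store ''offset'' (IAdd (Reg ''k'') (INum 1))
       ((num ''slope'' *\<^sub>a (Get ''u'' at_back +\<^sub>a Get ''nu'' at_back)
         +\<^sub>a Get ''offset'' (Reg ''k'')
         -\<^sub>a (num ''x_now'' -\<^sub>a Get ''x'' at_back -\<^sub>a Get ''psi'' at_back)) /\<^sub>a num ''den'')"

definition zeta_init :: com where
  "zeta_init = set_num ''level'' (Const 0) ;; set_num ''drift'' (Const 0)"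

abbreviation to_go :: iexp where "to_go \<equiv> ISub (Reg ''N'') (Reg ''k'')"

text \<open>
  The forward pass of one row, together with the multipliers and residuals of that row.
  \<open>level\<close> and \<open>drift\<close> are the running sums of the new \<open>\<zeta>\<close> and of the decrease of \<open>\<zeta>\<close>, hence the
  entries of the products with \<open>\<Psi>\<close> in the two residuals. The multipliers \<open>\<nu>\<close> and \<open>\<psi>\<close> of a row
  may be overwritten here because the backward recursion of the column has already read them.
\<close>

definition zeta_step :: com where
  "zeta_step =
     set_num ''zeta_old'' (cur ''zeta'') ;;
     Store ''zeta'' at_k (cur ''u'' +\<^sub>a cur ''nu'' -\<^sub>a num ''rho2'' /\<^sub>a num ''rho1''
        *\<^sub>a (Get ''gain'' to_go *\<^sub>a num ''level'' +\<^sub>a Get ''offset'' to_go)) ;;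
     set_num ''level'' (num ''level'' +\<^sub>a cur ''zeta'') ;;
     set_num ''drift'' (num ''drift'' +\<^sub>a (num ''zeta_old'' -\<^sub>a cur ''zeta'')) ;;
     Store ''r1'' at_k (cur ''u'' -\<^sub>a cur ''zeta'') ;;
     Store ''r2'' at_k (cur ''x'' -\<^sub>a num ''x_now'' +\<^sub>a num ''level'') ;;
     Store ''nu'' at_k (cur ''nu'' +\<^sub>a cur ''r1'') ;;
     Store ''psi'' at_k (cur ''psi'' +\<^sub>a cur ''r2'') ;;
     Store ''s1'' at_k (num ''rho1'' *\<^sub>a (num ''zeta_old'' -\<^sub>a cur ''zeta'')) ;;
     Cond (ILess (INum 0) (Reg ''k'')) Skip
       (Store ''s1'' at_k (cur ''s1'' -\<^sub>a num ''rho3'' *\<^sub>a (num ''tau_old'' -\<^sub>a num ''tau''))) ;;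
     Store ''s2'' at_k (num ''rho2'' *\<^sub>a num ''drift'')"

definition zeta_end :: com where
  "zeta_end =
     Store ''r3'' (Reg ''s'') (num ''tau'' -\<^sub>a Get ''u'' at_0) ;;
     Store ''phi'' (Reg ''s'') (Get ''phi'' (Reg ''s'') +\<^sub>a Get ''r3'' (Reg ''s''))"

definition zeta_pass :: com where
  "zeta_pass = For ''s'' ''S''
     (riccati_init ;; For ''k'' ''N'' riccati_step ;; zeta_init ;; For ''k'' ''N'' zeta_step ;; zeta_end)"

definition admm_program :: com where
  "admm_program = ux_pass ;; zeta_pass"

section \<open>Partially updated matrices in memory\<close>

text \<open>
  The state of a matrix that is overwritten column by column when the loops have reached row \<open>k\<close>
  of column \<open>s\<close>.
\<close>

definition blend :: "nat \<Rightarrow> nat \<Rightarrow> rmat \<Rightarrow> rmat \<Rightarrow> rmat" where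
  "blend s k w' w = (\<lambda>k' s'. if s' < s \<or> s' = s \<and> k' < k then w' k' s' else w k' s')"

definition stored :: "machine \<Rightarrow> string \<Rightarrow> mpc \<Rightarrow> rmat" where
  "stored m a d = (\<lambda>k s. mem m a (s * hor d + k))"

lemma holds_mat_stored: "holds_mat m a d (stored m a d)"
  by (simp add: holds_mat_def stored_def)

lemma holds_mat_cong:
  "(\<And>k s. k < hor d \<Longrightarrow> s < scen d \<Longrightarrow> w k s = w' k s) \<Longrightarrow> holds_mat m a d w = holds_mat m a d w'"
  by (simp add: holds_mat_def)

lemma holds_mat_blend_start: "holds_mat m a d (blend 0 0 w' w) = holds_mat m a d w"
  by (simp add: blend_def)

lemma holds_mat_blend_column:
  "holds_mat m a d (blend s (hor d) w' w) = holds_mat m a d (blend (Suc s) 0 w' w)"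
  by (rule holds_mat_cong) (auto simp: blend_def less_Suc_eq)

lemma holds_mat_blend_end: "holds_mat m a d (blend (scen d) 0 w' w) = holds_mat m a d w'"
  by (rule holds_mat_cong) (auto simp: blend_def)

lemma holds_mat_read:
  "holds_mat m a d w \<Longrightarrow> s < scen d \<Longrightarrow> k < hor d \<Longrightarrow> mem m a (s * hor d + k) = w k s"
  by (simp add: holds_mat_def)

lemma flat_index_eq_iff:
  assumes "k < n" "k' < (n::nat)"
  shows "s * n + k = s' * n + k' \<longleftrightarrow> s = s' \<and> k = k'"
proof
  assume eq: "s * n + k = s' * n + k'"
  have "(s * n + k) div n = s" "(s' * n + k') div n = s'" using assms by auto
  with eq have "s = s'" by metis
  with eq show "s = s' \<and> k = k'" by simp
qed simp

lemma holds_mat_set_mem [simp]: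
  "a \<noteq> b \<Longrightarrow> holds_mat (set_mem b i v m) a d w = holds_mat m a d w"
  by (simp add: holds_mat_def)

lemma holds_mat_set_reg [simp]: "holds_mat (set_reg r n m) a d w = holds_mat m a d w"
  by (simp add: holds_mat_def)

lemma holds_mat_store_blend:
  assumes "holds_mat m a d (blend s k w' w)" and k: "s < scen d" "k < hor d" and v: "v = w' k s"
  shows "holds_mat (set_mem a (s * hor d + k) v m) a d (blend s (Suc k) w' w)"
  unfolding holds_mat_def
proof (intro allI impI)
  fix s' k' assume "s' < scen d" "k' < hor d"
  then have "mem m a (s' * hor d + k') = blend s k w' w k' s'"
    using assms(1) by (simp add: holds_mat_def)
  then show "mem (set_mem a (s * hor d + k) v m) a (s' * hor d + k') = blend s (Suc k) w' w k' s'"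
    using flat_index_eq_iff[OF k(2) \<open>k' < hor d\<close>, of s s'] v
    by (auto simp: blend_def less_Suc_eq)
qed

lemma holds_num_set_mem [simp]:
  "a \<noteq> b \<Longrightarrow> holds_num (set_mem b i v m) a w = holds_num m a w"
  "holds_num (set_mem a 0 v m) a w \<longleftrightarrow> v = w"
  "holds_num (set_reg r n m) a w = holds_num m a w"
  by (auto simp: holds_num_def)

lemma holds_vec_set_mem [simp]:
  "a \<noteq> b \<Longrightarrow> holds_vec (set_mem b i v m) a n w = holds_vec m a n w"
  "holds_vec (set_reg r j m) a n w = holds_vec m a n w"
  by (auto simp: holds_vec_def)

lemma holds_vec_append:
  "holds_vec m a n w \<Longrightarrow> v = w n \<Longrightarrow> holds_vec (set_mem a n v m) a (Suc n) w"
  by (auto simp: holds_vec_def less_Suc_eq)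

lemma holds_data_set_reg [simp]:
  "r \<noteq> ''N'' \<Longrightarrow> r \<noteq> ''S'' \<Longrightarrow> holds_data (set_reg r n m) d = holds_data m d"
  by (simp add: holds_data_def)

lemma holds_data_set_mem [simp]:
  "a \<notin> {''x_now'', ''x_lo'', ''x_hi'', ''u_lo'', ''u_hi'', ''eng_on'', ''fq2'', ''fq1'', ''fq0'',
     ''p_out'', ''beta0'', ''beta1'', ''beta2'', ''resist'', ''volt'', ''rho1'', ''rho2'', ''rho3''} \<Longrightarrow>
   holds_data (set_mem a i v m) d = holds_data m d"
  unfolding insert_iff de_Morgan_disj holds_data_def
  by (elim conjE) (simp only: holds_mat_set_mem holds_num_set_mem holds_vec_set_mem reg_simps not_sym[of a] simp_thms)


lemma holds_data_read:
  assumes "holds_data m d" "s < scen d" "k < hor d"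
  shows "regs m ''N'' = hor d" "regs m ''S'' = scen d"
    "mem m ''x_now'' 0 = x_now d" "mem m ''x_lo'' 0 = x_lo d" "mem m ''x_hi'' 0 = x_hi d"
    "mem m ''rho1'' 0 = rho1 d" "mem m ''rho2'' 0 = rho2 d" "mem m ''rho3'' 0 = rho3 d"
    "mem m ''resist'' k = resist d k" "mem m ''volt'' k = volt d k"
    "mem m ''u_lo'' (s * hor d + k) = u_lo d k s" "mem m ''u_hi'' (s * hor d + k) = u_hi d k s"
    "mem m ''eng_on'' (s * hor d + k) = (if k \<in> eng_on d s then 1 else 0)"
    "mem m ''fq2'' (s * hor d + k) = fq2 d k s" "mem m ''fq1'' (s * hor d + k) = fq1 d k s"
    "mem m ''fq0'' (s * hor d + k) = fq0 d k s" "mem m ''p_out'' (s * hor d + k) = p_out d k s"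
    "mem m ''beta0'' (s * hor d + k) = beta0 d k s" "mem m ''beta1'' (s * hor d + k) = beta1 d k s"
    "mem m ''beta2'' (s * hor d + k) = beta2 d k s"
  using assms by (simp_all add: holds_data_def holds_mat_def holds_num_def holds_vec_def)

text \<open>
  \<open>holds_prefix\<close> is for arrays that are only written; the quantifier absorbs their initial contents.
\<close>

definition holds_prefix :: "machine \<Rightarrow> string \<Rightarrow> mpc \<Rightarrow> nat \<Rightarrow> nat \<Rightarrow> rmat \<Rightarrow> bool" where
  "holds_prefix m a d s k w' \<longleftrightarrow> (\<exists>w. holds_mat m a d (blend s k w' w))"

lemma holds_prefix_start: "holds_prefix m a d 0 0 w"
  unfolding holds_prefix_def using holds_mat_stored holds_mat_blend_start by blast

lemma holds_prefix_column: "holds_prefix m a d s (hor d) w \<Longrightarrow> holds_prefix m a d (Suc s) 0 w"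
  by (simp add: holds_prefix_def holds_mat_blend_column)

lemma holds_prefix_end: "holds_prefix m a d (scen d) 0 w \<Longrightarrow> holds_mat m a d w"
  by (auto simp: holds_prefix_def holds_mat_blend_end)

lemma holds_prefix_read:
  "holds_prefix m a d s k w \<Longrightarrow> s' < scen d \<Longrightarrow> k' < hor d \<Longrightarrow> s' < s \<or> s' = s \<and> k' < k \<Longrightarrow>
   mem m a (s' * hor d + k') = w k' s'"
  by (auto simp: holds_prefix_def blend_def dest: holds_mat_read)

lemma holds_prefix_set_mem [simp]:
  "a \<noteq> b \<Longrightarrow> holds_prefix (set_mem b i v m) a d s k w = holds_prefix m a d s k w"
  "holds_prefix (set_reg r n m) a d s k w = holds_prefix m a d s k w"
  by (simp_all add: holds_prefix_def)

lemma holds_prefix_store: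
  "holds_prefix m a d s k w \<Longrightarrow> s < scen d \<Longrightarrow> k < hor d \<Longrightarrow> v = w k s \<Longrightarrow>
   holds_prefix (set_mem a (s * hor d + k) v m) a d s (Suc k) w"
  unfolding holds_prefix_def using holds_mat_store_blend by blast

section \<open>Correctness of the first pass\<close>

locale admm_step =
  fixes d :: mpc and \<tau> :: real and \<zeta> \<nu> \<psi> :: rmat and \<phi> :: "nat \<Rightarrow> real"
  assumes valid: "valid_mpc d"
begin

abbreviation "N \<equiv> hor d"
abbreviation "S \<equiv> scen d"

lemma N_pos: "0 < N" and S_pos: "0 < S"
  using valid by (auto simp: valid_mpc_def)

definition "u' = u_new d (\<tau>, \<zeta>) (\<nu>, \<psi>, \<phi>)"
definition "x' = x_new d (\<tau>, \<zeta>) (\<nu>, \<psi>, \<phi>)"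

definition ux_base :: "machine \<Rightarrow> bool" where
  "ux_base m \<longleftrightarrow> holds_data m d \<and> holds_tz m d (\<tau>, \<zeta>) \<and> holds_mult m d (\<nu>, \<psi>, \<phi>)"

definition ux_done :: "nat \<Rightarrow> nat \<Rightarrow> machine \<Rightarrow> bool" where
  "ux_done s k m \<longleftrightarrow> ux_base m \<and>
     holds_prefix m ''u'' d s k u' \<and> holds_prefix m ''x'' d s k (\<lambda>k. x' (Suc k)) \<and>
     holds_num m ''sum'' (\<Sum>i<s. u' 0 i - \<phi> i) \<and> holds_num m ''count'' (real s)"

lemma oval_u_obj:
  assumes m: "ux_base m" "regs m ''s'' = s" "regs m ''k'' = k" and s: "s < S" and k: "k < N"
    and on: "k \<in> eng_on d s"
  shows "k > 0 \<Longrightarrow> oval u_obj_exp m = u_obj d (\<tau>, \<zeta>) (\<nu>, \<psi>, \<phi>) k s"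
    and "k = 0 \<Longrightarrow> oval u0_obj_exp m = u_obj d (\<tau>, \<zeta>) (\<nu>, \<psi>, \<phi>) k s"
proof -
  have data: "holds_data m d" using m by (simp add: ux_base_def)
  note read = holds_data_read[OF data s k]
  have iter: "mem m ''zeta'' (s * N + k) = \<zeta> k s" "mem m ''nu'' (s * N + k) = \<nu> k s"
    "mem m ''tau'' 0 = \<tau>" "mem m ''phi'' s = \<phi> s"
    using m s k by (auto simp: ux_base_def holds_mat_def holds_num_def holds_vec_def)
  have at: "ival at_k m = s * N + k" using m read by (simp add: at_k_def)
  have "oval radicand_exp m v = g_inv_radicand d k s v" for v
    by (simp add: radicand_exp_def at m read g_inv_radicand_def power2_eq_square)
  then have "oval engine_exp m v = p_out d k s - g_inv d k s v" for v
    by (simp add: engine_exp_def at m read g_inv_def)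
  then have u: "oval u_obj_exp m v = fuel d k s v + rho1 d / 2 * (v - \<zeta> k s + \<nu> k s)\<^sup>2" for v
    by (simp add: u_obj_exp_def at m read iter fuel_def fuel_quad_def power2_eq_square)
  show "k > 0 \<Longrightarrow> oval u_obj_exp m = u_obj d (\<tau>, \<zeta>) (\<nu>, \<psi>, \<phi>) k s"
    by (rule ext) (simp add: u u_obj_def on)
  show "k = 0 \<Longrightarrow> oval u0_obj_exp m = u_obj d (\<tau>, \<zeta>) (\<nu>, \<psi>, \<phi>) k s"
    by (rule ext) (use on m read iter in \<open>simp add: u u_obj_def u0_obj_exp_def power2_eq_square\<close>)
qed

lemma oval_x_obj:
  assumes m: "ux_base m" "regs m ''s'' = s" "regs m ''k'' = k"
    and level: "mem m ''level'' 0 = (\<Sum>j<Suc k. \<zeta> j s)" and s: "s < S" and k: "k < N"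
  shows "oval x_obj_exp m = x_obj d (\<tau>, \<zeta>) (\<nu>, \<psi>, \<phi>) k s"
proof -
  have data: "holds_data m d" using m by (simp add: ux_base_def)
  note read = holds_data_read[OF data s k]
  have iter: "mem m ''psi'' (s * N + k) = \<psi> k s"
    using m s k by (auto simp: ux_base_def holds_mat_def)
  have at: "ival at_k m = s * N + k" using m read by (simp add: at_k_def)
  show ?thesis
    by (rule ext) (simp add: x_obj_exp_def x_obj_def at read iter level Psi_mult_prefix[OF k]
        power2_eq_square del: sum.lessThan_Suc)
qed

lemma ux_base_set [simp]:
  "a \<in> {''level'', ''u'', ''x'', ''sum'', ''count''} \<Longrightarrow> ux_base (set_mem a i v m) = ux_base m"
  "r \<in> {''s'', ''k''} \<Longrightarrow> ux_base (set_reg r n m) = ux_base m"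
  by (auto simp: ux_base_def)

text \<open>
  The machine's minimizer and \<open>u_new\<close>, \<open>x_new\<close> are the same choice \<open>arg_min_on\<close>, so it
  suffices that the objective expressions denote the right functions.
\<close>

lemma ux_step_correct:
  assumes s: "s < S" and k: "k < N" and m: "regs m ''s'' = s" "regs m ''k'' = k" "ux_done s k m"
    and level: "holds_num m ''level'' (\<Sum>j<k. \<zeta> j s)"
  shows "wp ux_step (\<lambda>m'. regs m' ''s'' = s \<and> regs m' ''k'' = k \<and> ux_done s (Suc k) m' \<and>
    holds_num m' ''level'' (\<Sum>j<Suc k. \<zeta> j s)) m" (is "wp _ ?Q m")
proof -
  define m1 where "m1 = set_mem ''level'' 0 (\<Sum>j<Suc k. \<zeta> j s) m"
  define m2 where "m2 = set_mem ''x'' (s * N + k) (x' (Suc k) s) m1"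
  define m3 where "m3 = set_mem ''u'' (s * N + k) (u' k s) m2"
  have base: "ux_base m" using m by (simp add: ux_done_def)
  then have bases: "ux_base m1" "ux_base m2" by (simp_all add: m1_def m2_def)
  then have datas: "holds_data m1 d" "holds_data m2 d" by (simp_all add: ux_base_def)
  have regs: "regs m1 ''s'' = s" "regs m1 ''k'' = k" "regs m2 ''s'' = s" "regs m2 ''k'' = k"
    using m by (simp_all add: m1_def m2_def)
  note read1 = holds_data_read[OF datas(1) s k] and read2 = holds_data_read[OF datas(2) s k]
  have at: "ival at_k m1 = s * N + k" "ival at_k m2 = s * N + k"
    using regs read1 read2 by (simp_all add: at_k_def)
  have U: "U_int d k s \<noteq> {}" and X: "X_int d \<noteq> {}"
    using valid s k by (auto simp: valid_mpc_def U_int_def X_int_def)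
  have Q: "?Q m3"
    using m s k level
    by (auto simp: m3_def m2_def m1_def ux_done_def intro!: holds_prefix_store)
  note arg = wp_Argmin[where Q = ?Q and D = "U_int d k s", OF _ _ U u_obj_convex[OF valid s k] u_obj_continuous[OF valid s k]]
  have step_u: "wp (Cond (ALess (Const 0) (cur ''eng_on''))
       (Cond (ILess (INum 0) (Reg ''k''))
         (Argmin ''u'' at_k u_obj_exp (cur ''u_lo'') (cur ''u_hi''))
         (Argmin ''u'' at_k u0_obj_exp (cur ''u_lo'') (cur ''u_hi'')))
       (Store ''u'' at_k (cur ''u_lo''))) ?Q m2" (is "wp ?c _ _")
  proof (cases "k \<in> eng_on d s")
    case True
    have bounds: "{aval (cur ''u_lo'') m2..aval (cur ''u_hi'') m2} = U_int d k s"
      by (simp add: at read2 U_int_def)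
    have store: "?Q (set_mem ''u'' (ival at_k m2)
        (arg_min_on (u_obj d (\<tau>, \<zeta>) (\<nu>, \<psi>, \<phi>) k s) (U_int d k s)) m2)"
      using Q unfolding at by (simp add: m3_def u'_def u_new_def)
    note obj = oval_u_obj[OF bases(2) regs(3,4) s k True]
    have on: "bval (ALess (Const 0) (cur ''eng_on'')) m2" using True by (simp add: at read2)
    show ?thesis
    proof (cases "k = 0")
      case True
      then have "\<not> bval (ILess (INum 0) (Reg ''k'')) m2" using regs by simp
      then show ?thesis
        unfolding wp.simps(6) using on
        by (simp only: if_True if_False) (rule arg[OF bounds obj(2)[OF True] store])
    next
      case False
      then have "bval (ILess (INum 0) (Reg ''k'')) m2" using regs by simp
      then show ?thesis
        unfolding wp.simps(6) using on False
        by (simp only: if_True) (rule arg[OF bounds obj(1) store], simp)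
    qed
  next
    case False
    have "u' k s \<in> U_int d k s"
      using u_new_arg_min[OF valid s k] by (auto simp: u'_def is_arg_min_def)
    moreover have "u_lo d k s = u_hi d k s"
      using valid s k False by (auto simp: valid_mpc_def)
    ultimately have "u' k s = u_lo d k s" by (simp add: U_int_def)
    with False Q show ?thesis by (simp add: at read2 m3_def)
  qed
  have "wp (Argmin ''x'' at_k x_obj_exp (num ''x_lo'') (num ''x_hi'')) (wp ?c ?Q) m1"
  proof (rule wp_Argmin[OF _ _ X x_obj_convex[OF valid] x_obj_continuous])
    show "{aval (num ''x_lo'') m1..aval (num ''x_hi'') m1} = X_int d"
      by (simp add: read1 X_int_def)
    show "oval x_obj_exp m1 = x_obj d (\<tau>, \<zeta>) (\<nu>, \<psi>, \<phi>) k s"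
      by (rule oval_x_obj[OF bases(1) regs(1,2) _ s k]) (simp add: m1_def)
    show "wp ?c ?Q (set_mem ''x'' (ival at_k m1)
        (arg_min_on (x_obj d (\<tau>, \<zeta>) (\<nu>, \<psi>, \<phi>) k s) (X_int d)) m1)"
      using step_u unfolding at by (simp add: m2_def x'_def x_new_def)
  qed
  moreover have "set_mem ''level'' (ival (INum 0) m) (aval (num ''level'' +\<^sub>a cur ''zeta'') m) m = m1"
  proof -
    have "holds_data m d" using base by (simp add: ux_base_def)
    moreover have "mem m ''zeta'' (s * N + k) = \<zeta> k s"
      using base s k by (auto simp: ux_base_def holds_mat_def)
    ultimately show ?thesis
      using level m holds_data_read(1)[OF _ s k, of m] by (simp add: m1_def at_k_def holds_num_def)
  qed
  ultimately show ?thesis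
    unfolding ux_step_def wp.simps(3,5) by simp
qed


lemma ux_done_set_reg [simp]: "r \<in> {''s'', ''k''} \<Longrightarrow> ux_done s k (set_reg r n m) = ux_done s k m"
  by (auto simp: ux_done_def)

lemma ux_done_regs: "ux_done s k m \<Longrightarrow> regs m ''N'' = N" "ux_done s k m \<Longrightarrow> regs m ''S'' = S"
  by (simp_all add: ux_done_def ux_base_def holds_data_def)

definition "ux_col_time =
  straight_cost (set_num ''level'' (Const 0)) +
    (3 + N * (straight_cost ux_step + 4) + straight_cost ux_end)"

lemma ux_column_correct:
  assumes s: "s < S" and m: "regs m ''s'' = s" "ux_done s 0 m"
  shows "reaches (set_num ''level'' (Const 0) ;; For ''k'' ''N'' ux_step ;; ux_end) ux_col_time
    (\<lambda>m'. regs m' ''s'' = s \<and> ux_done (Suc s) 0 m') m"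
  unfolding ux_col_time_def
proof (intro reaches_Seq)
  let ?I = "\<lambda>k m. regs m ''s'' = s \<and> ux_done s k m \<and> holds_num m ''level'' (\<Sum>j<k. \<zeta> j s)"
  show "reaches (set_num ''level'' (Const 0)) (straight_cost (set_num ''level'' (Const 0))) (?I 0) m"
    using m by (intro reaches_wp) (simp add: ux_done_def)
  fix m assume I: "?I 0 m"
  show "reaches (For ''k'' ''N'' ux_step) (3 + N * (straight_cost ux_step + 4)) (?I N) m"
  proof (rule reaches_For)
    fix k m
    assume k: "k < N" "regs m ''k'' = k" "regs m ''N'' = N" and I: "?I k m"
    then have I': "regs m ''s'' = s" "ux_done s k m" "holds_num m ''level'' (\<Sum>j<k. \<zeta> j s)" by auto
    show "reaches ux_step (straight_cost ux_step)
        (\<lambda>m'. regs m' ''k'' = k \<and> regs m' ''N'' = N \<and> ?I (Suc k) (set_reg ''k'' (Suc k) m')) m"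
      by (rule reaches_wp, rule wp_mono[OF ux_step_correct[OF s k(1) I'(1) k(2) I'(2,3)]])
        (auto dest: ux_done_regs)
  qed (use I in \<open>auto dest: ux_done_regs\<close>)
next
  fix m assume I: "regs m ''s'' = s \<and> ux_done s N m \<and> holds_num m ''level'' (\<Sum>j<N. \<zeta> j s)"
  then have data: "holds_data m d" and phi: "mem m ''phi'' s = \<phi> s" and u: "mem m ''u'' (s * N) = u' 0 s"
    using s N_pos holds_prefix_read[of m "''u''" d s N u' s 0]
    by (auto simp: ux_done_def ux_base_def holds_vec_def)
  show "reaches ux_end (straight_cost ux_end) (\<lambda>m'. regs m' ''s'' = s \<and> ux_done (Suc s) 0 m') m"
    using I phi u holds_data_read(1)[OF data s N_pos]
    by (intro reaches_wp) (auto simp: ux_end_def at_0_def ux_done_def holds_num_def holds_prefix_column)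
qed

section \<open>The exact iteration\<close>

definition "\<tau>' = tau_new d (u', x') (\<nu>, \<psi>, \<phi>)"
definition "\<zeta>' = zeta_new d (u', x') (\<nu>, \<psi>, \<phi>)"
definition "r1 k s = u' k s - \<zeta>' k s"
definition "r2 k s = x' (Suc k) s - x_now d + Psi_mult d \<zeta>' k s"
definition "r3 s = \<tau>' - u' 0 s"
definition "s1 k s = rho1 d * (\<zeta> k s - \<zeta>' k s) - M_vec d k s * (\<tau> - \<tau>')"
definition "s2 k s = rho2 d * Psi_mult d (\<lambda>k s. \<zeta> k s - \<zeta>' k s) k s"

lemma admm_iteration_new:
  "admm_iteration d (\<tau>, \<zeta>) (\<nu>, \<psi>, \<phi>) (u', x') (\<tau>', \<zeta>')
    (\<lambda>k s. \<nu> k s + r1 k s, \<lambda>k s. \<psi> k s + r2 k s, \<lambda>s. \<phi> s + r3 s) (r1, r2, r3) (s1, s2)"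
  unfolding admm_iteration_def
proof (intro conjI)
  show "is_arg_min (\<lambda>ut. lagrangian d ut (\<tau>, \<zeta>) (\<nu>, \<psi>, \<phi>)) (\<lambda>_. True) (u', x')"
    unfolding u'_def x'_def by (rule lagrangian_arg_min_ux[OF valid])
  show "is_arg_min (\<lambda>z. lagrangian d (u', x') z (\<nu>, \<psi>, \<phi>)) (\<lambda>_. True) (\<tau>', \<zeta>')"
    unfolding \<tau>'_def \<zeta>'_def
    by (rule lagrangian_arg_min_tz[OF valid]) (simp add: u'_def x'_def new_in_bounds[OF valid])
qed (simp_all add: r1_def r2_def r3_def s1_def s2_def fun_eq_iff)

section \<open>From the first to the second pass\<close>

definition tz_base :: "machine \<Rightarrow> bool" where
  "tz_base m \<longleftrightarrow> holds_data m d \<and> holds_num m ''tau'' \<tau>' \<and> holds_num m ''tau_old'' \<tau> \<and>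
     holds_mat m ''u'' d u' \<and> holds_mat m ''x'' d (\<lambda>k. x' (Suc k))"

definition tz_done :: "nat \<Rightarrow> nat \<Rightarrow> machine \<Rightarrow> bool" where
  "tz_done s k m \<longleftrightarrow> tz_base m \<and>
     holds_mat m ''zeta'' d (blend s k \<zeta>' \<zeta>) \<and>
     holds_mat m ''nu'' d (blend s k (\<lambda>k s. \<nu> k s + r1 k s) \<nu>) \<and>
     holds_mat m ''psi'' d (blend s k (\<lambda>k s. \<psi> k s + r2 k s) \<psi>) \<and>
     holds_vec m ''phi'' S (\<lambda>i. if i < s then \<phi> i + r3 i else \<phi> i) \<and>
     holds_prefix m ''r1'' d s k r1 \<and> holds_prefix m ''r2'' d s k r2 \<and> holds_vec m ''r3'' s r3 \<and>
     holds_prefix m ''s1'' d s k s1 \<and> holds_prefix m ''s2'' d s k s2"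

definition "ux_time =
  straight_cost (set_num ''sum'' (Const 0) ;; set_num ''count'' (Const 0)) +
  (3 + S * (ux_col_time + 4) +
   straight_cost (set_num ''tau_old'' (num ''tau'') ;; set_num ''tau'' (num ''sum'' /\<^sub>a num ''count'')))"

lemma ux_pass_correct:
  assumes m: "ux_base m"
  shows "reaches ux_pass ux_time (tz_done 0 0) m"
  unfolding ux_pass_def ux_time_def
proof (intro reaches_Seq)
  show "reaches (set_num ''sum'' (Const 0) ;; set_num ''count'' (Const 0))
      (straight_cost (set_num ''sum'' (Const 0) ;; set_num ''count'' (Const 0))) (ux_done 0 0) m"
    using m by (intro reaches_wp) (simp add: ux_done_def holds_prefix_start)
  fix m assume I: "ux_done 0 0 m"
  show "reaches (For ''s'' ''S'' (set_num ''level'' (Const 0) ;; For ''k'' ''N'' ux_step ;; ux_end))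
      (3 + S * (ux_col_time + 4)) (ux_done S 0) m"
  proof (rule reaches_For)
    fix s m
    assume "s < S" "regs m ''s'' = s" "ux_done s 0 m"
    from ux_column_correct[OF this]
    show "reaches (set_num ''level'' (Const 0) ;; For ''k'' ''N'' ux_step ;; ux_end) ux_col_time
        (\<lambda>m'. regs m' ''s'' = s \<and> regs m' ''S'' = S \<and> ux_done (Suc s) 0 (set_reg ''s'' (Suc s) m')) m"
      by (rule reaches_mono) (auto dest: ux_done_regs)
  qed (use I in \<open>auto dest: ux_done_regs\<close>)
next
  fix m assume "ux_done S 0 m"
  then show "reaches (set_num ''tau_old'' (num ''tau'') ;; set_num ''tau'' (num ''sum'' /\<^sub>a num ''count''))
      (straight_cost (set_num ''tau_old'' (num ''tau'') ;; set_num ''tau'' (num ''sum'' /\<^sub>a num ''count'')))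
      (tz_done 0 0) m"
    by (intro reaches_wp)
      (simp add: ux_done_def ux_base_def tz_done_def tz_base_def holds_prefix_start holds_prefix_end
        holds_mat_blend_start holds_num_def \<tau>'_def tau_new_def, simp add: holds_vec_def)
qed


section \<open>Correctness of the second pass\<close>

abbreviation "target s \<equiv> zeta_target u' \<nu> s"
abbreviation "goal s \<equiv> level_target d x' \<psi> s"
abbreviation "ratio \<equiv> rho2 d / rho1 d"

definition riccati_done :: "nat \<Rightarrow> nat \<Rightarrow> machine \<Rightarrow> bool" where
  "riccati_done s i m \<longleftrightarrow> holds_vec m ''gain'' (Suc i) (gain ratio) \<and>
     holds_vec m ''offset'' (Suc i) (offset N ratio (target s) (goal s))"

lemma tz_base_set [simp]:
  "a \<in> {''zeta'', ''nu'', ''psi'', ''phi'', ''r1'', ''r2'', ''r3'', ''s1'', ''s2'',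
     ''gain'', ''offset'', ''slope'', ''den'', ''level'', ''drift'', ''zeta_old''} \<Longrightarrow>
   tz_base (set_mem a i v m) = tz_base m"
  "r \<in> {''s'', ''k''} \<Longrightarrow> tz_base (set_reg r n m) = tz_base m"
  by (auto simp: tz_base_def)

lemma tz_done_set [simp]:
  "a \<in> {''gain'', ''offset'', ''slope'', ''den'', ''level'', ''drift'', ''zeta_old''} \<Longrightarrow>
   tz_done s k (set_mem a i v m) = tz_done s k m"
  "r \<in> {''s'', ''k''} \<Longrightarrow> tz_done s k (set_reg r n m) = tz_done s k m"
  by (auto simp: tz_done_def)

lemma riccati_done_set [simp]:
  "a \<notin> {''gain'', ''offset''} \<Longrightarrow> riccati_done s i (set_mem a j v m) = riccati_done s i m"
  "riccati_done s i (set_reg r n m) = riccati_done s i m"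
  by (auto simp: riccati_done_def)

lemma tz_done_regs: "tz_done s k m \<Longrightarrow> regs m ''N'' = N" "tz_done s k m \<Longrightarrow> regs m ''S'' = S"
  by (simp_all add: tz_done_def tz_base_def holds_data_def)

lemma tz_done_read:
  assumes "tz_done s k m" and s: "s < S" and j: "j < N"
  shows "mem m ''u'' (s * N + j) = u' j s" "mem m ''x'' (s * N + j) = x' (Suc j) s"
    "k \<le> j \<Longrightarrow> mem m ''zeta'' (s * N + j) = \<zeta> j s"
    "k \<le> j \<Longrightarrow> mem m ''nu'' (s * N + j) = \<nu> j s"
    "k \<le> j \<Longrightarrow> mem m ''psi'' (s * N + j) = \<psi> j s"
    "mem m ''tau'' 0 = \<tau>'" "mem m ''tau_old'' 0 = \<tau>"
    "mem m ''phi'' s = \<phi> s"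
proof -
  have "holds_mat m ''u'' d u'" "holds_mat m ''x'' d (\<lambda>k. x' (Suc k))"
    "holds_mat m ''zeta'' d (blend s k \<zeta>' \<zeta>)"
    "holds_mat m ''nu'' d (blend s k (\<lambda>k s. \<nu> k s + r1 k s) \<nu>)"
    "holds_mat m ''psi'' d (blend s k (\<lambda>k s. \<psi> k s + r2 k s) \<psi>)"
    using assms(1) by (simp_all add: tz_done_def tz_base_def)
  note this[THEN holds_mat_read, OF s j]
  then show "mem m ''u'' (s * N + j) = u' j s" "mem m ''x'' (s * N + j) = x' (Suc j) s"
    "k \<le> j \<Longrightarrow> mem m ''zeta'' (s * N + j) = \<zeta> j s"
    "k \<le> j \<Longrightarrow> mem m ''nu'' (s * N + j) = \<nu> j s"
    "k \<le> j \<Longrightarrow> mem m ''psi'' (s * N + j) = \<psi> j s"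
    by (simp_all add: blend_def)
  show "mem m ''tau'' 0 = \<tau>'" "mem m ''tau_old'' 0 = \<tau>" "mem m ''phi'' s = \<phi> s"
    using assms(1) s by (simp_all add: tz_done_def tz_base_def holds_num_def holds_vec_def)
qed

lemma riccati_step_correct:
  assumes s: "s < S" and i: "i < N" and m: "regs m ''s'' = s" "regs m ''k'' = i"
    and I: "tz_done s 0 m" "riccati_done s i m"
  shows "wp riccati_step (\<lambda>m'. regs m' ''s'' = s \<and> regs m' ''k'' = i \<and> tz_done s 0 m' \<and>
    riccati_done s (Suc i) m') m"
proof -
  define k where "k = N - Suc i"
  have k: "k < N" using i by (simp add: k_def)
  have data: "holds_data m d" using I by (simp add: tz_done_def tz_base_def)
  have read: "mem m ''u'' (s * N + k) = u' k s" "mem m ''x'' (s * N + k) = x' (Suc k) s"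
    "mem m ''nu'' (s * N + k) = \<nu> k s" "mem m ''psi'' (s * N + k) = \<psi> k s"
    using tz_done_read[OF I(1) s k] by auto
  define g h g' h' slope den where "g = gain ratio i"
    and "h = offset N ratio (target s) (goal s) i"
    and "g' = gain ratio (Suc i)" and "h' = offset N ratio (target s) (goal s) (Suc i)"
    and "slope = 1 + g" and "den = 1 + ratio * slope"
  have state: "mem m ''gain'' i = g" "mem m ''offset'' i = h"
    using I(2) by (auto simp: riccati_done_def holds_vec_def g_def h_def)
  have g': "slope / den = g'"
    unfolding g'_def slope_def den_def g_def gain.simps ..
  have h': "(slope * (u' k s + \<nu> k s) + h - (x_now d - x' (Suc k) s - \<psi> k s)) / den = h'"
    unfolding h'_def slope_def den_def g_def h_def offset.simps k_def zeta_target_def level_target_def ..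
  have at: "ival at_back m' = s * N + k" if "regs m' = regs m" for m'
    using that m holds_data_read(1)[OF data s k] by (simp add: at_back_def k_def)
  note data_read = holds_data_read[OF data s k]
  show ?thesis
    unfolding riccati_step_def wp.simps(5)
  proof (rule wp_Store[where j = 0 and v = slope], goal_cases)
    case 3 show ?case
    proof (rule wp_Store[where j = 0 and v = den], goal_cases)
      case 3 show ?case
      proof (rule wp_Store[where j = "Suc i" and v = g'], goal_cases)
        case 3 show ?case
        proof (rule wp_Store[where j = "Suc i" and v = h'], goal_cases)
          case 2 show ?case using h' by (simp add: at data_read read state m)
        next
          case 3
          show ?case
            using I m by (simp add: riccati_done_def holds_vec_append g'_def h'_def
                del: gain.simps offset.simps)
        qed (simp add: m)
      qed (simp_all add: m g')
    qed (simp_all add: den_def data_read)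
  qed (simp_all add: m state slope_def)
qed

definition zeta_loop :: "nat \<Rightarrow> nat \<Rightarrow> machine \<Rightarrow> bool" where
  "zeta_loop s k m \<longleftrightarrow> tz_done s k m \<and> riccati_done s N m \<and>
     holds_num m ''level'' (\<Sum>j<k. \<zeta>' j s) \<and> holds_num m ''drift'' (\<Sum>j<k. \<zeta> j s - \<zeta>' j s)"

text \<open>
  The new \<open>\<zeta>\<close> in the form in which the program computes it.
\<close>

lemma zeta'_step:
  "\<zeta>' k s = u' k s + \<nu> k s
     - ratio * (gain ratio (N - k) * (\<Sum>j<k. \<zeta>' j s) + offset N ratio (target s) (goal s) (N - k))"
  by (simp add: \<zeta>'_def zeta_new_prefix) (simp add: zeta_new_def opt_level_def zeta_target_def)

lemma zeta_step_correct:
  assumes s: "s < S" and k: "k < N" and m: "regs m ''s'' = s" "regs m ''k'' = k"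
    and I: "zeta_loop s k m"
  shows "wp zeta_step (\<lambda>m'. regs m' ''s'' = s \<and> regs m' ''k'' = k \<and> zeta_loop s (Suc k) m') m" (is "wp _ ?Q m")
proof -
  define z where "z = \<zeta>' k s"
  have I1: "tz_done s k m" using I by (simp add: zeta_loop_def)
  then have data: "holds_data m d" by (simp add: tz_done_def tz_base_def)
  have read: "mem m ''u'' (s * N + k) = u' k s" "mem m ''x'' (s * N + k) = x' (Suc k) s"
    "mem m ''zeta'' (s * N + k) = \<zeta> k s"
    "mem m ''nu'' (s * N + k) = \<nu> k s" "mem m ''psi'' (s * N + k) = \<psi> k s"
    "mem m ''tau'' 0 = \<tau>'" "mem m ''tau_old'' 0 = \<tau>"
    using tz_done_read[OF I1 s k] by auto
  have state: "mem m ''gain'' (N - k) = gain ratio (N - k)"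
    "mem m ''offset'' (N - k) = offset N ratio (target s) (goal s) (N - k)"
    "mem m ''level'' 0 = (\<Sum>j<k. \<zeta>' j s)" "mem m ''drift'' 0 = (\<Sum>j<k. \<zeta> j s - \<zeta>' j s)"
    using I by (auto simp: zeta_loop_def riccati_done_def holds_vec_def holds_num_def)
  have at: "ival at_k m' = s * N + k" if "regs m' ''N'' = N" "regs m' ''s'' = s" "regs m' ''k'' = k" for m'
    using that by (simp add: at_k_def)
  note data_read = holds_data_read[OF data s k]
  have r: "u' k s - z = r1 k s" "x' (Suc k) s - x_now d + ((\<Sum>j<k. \<zeta>' j s) + z) = r2 k s"
    using k by (simp_all add: z_def r1_def r2_def Psi_mult_prefix)
  have s1: "s1 k s = (if k = 0 then rho1 d * (\<zeta> k s - z) - rho3 d * (\<tau> - \<tau>') else rho1 d * (\<zeta> k s - z))"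
    by (simp add: z_def s1_def M_vec_def)
  have s2: "rho2 d * ((\<Sum>j<k. \<zeta> j s - \<zeta>' j s) + (\<zeta> k s - z)) = s2 k s"
    using k by (simp add: z_def s2_def Psi_mult_prefix)
  have z: "aval (cur ''u'' +\<^sub>a cur ''nu'' -\<^sub>a num ''rho2'' /\<^sub>a num ''rho1''
        *\<^sub>a (Get ''gain'' to_go *\<^sub>a num ''level'' +\<^sub>a Get ''offset'' to_go))
      (set_mem ''zeta_old'' 0 (\<zeta> k s) m) = z"
    by (simp add: at m data_read read state z_def zeta'_step[of k])
  \<comment> \<open>\<open>m1\<close>, \<open>m2\<close>, \<open>m3\<close>, \<open>m4\<close> are the machines after 2, 4, 8 and all statements; in \<open>m4\<close> a
      possible second store to \<open>s1\<close> is merged with the first.\<close>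
  define m1 where "m1 = set_mem ''zeta'' (s * N + k) z (set_mem ''zeta_old'' 0 (\<zeta> k s) m)"
  define m2 where "m2 = set_mem ''drift'' 0 ((\<Sum>j<k. \<zeta> j s - \<zeta>' j s) + (\<zeta> k s - z))
    (set_mem ''level'' 0 ((\<Sum>j<k. \<zeta>' j s) + z) m1)"
  define m3 where "m3 = set_mem ''psi'' (s * N + k) (\<psi> k s + r2 k s)
    (set_mem ''nu'' (s * N + k) (\<nu> k s + r1 k s)
    (set_mem ''r2'' (s * N + k) (r2 k s) (set_mem ''r1'' (s * N + k) (r1 k s) m2)))"
  define m4 where "m4 = set_mem ''s2'' (s * N + k) (s2 k s) (set_mem ''s1'' (s * N + k) (s1 k s) m3)"
  note machines = m1_def m2_def m3_def m4_def
  have final: "regs m4 ''s'' = s \<and> regs m4 ''k'' = k \<and> zeta_loop s (Suc k) m4"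
    using I m unfolding machines zeta_loop_def tz_done_def
    by (simp add: z_def s k holds_mat_store_blend holds_prefix_store)
  have last: "wp (Store ''s2'' at_k (num ''rho2'' *\<^sub>a num ''drift'')) ?Q
      (set_mem ''s1'' (s * N + k) (s1 k s) m3)"
    apply (rule wp_Store[where j = "s * N + k" and v = "s2 k s"])
      apply (simp add: at data_read m machines)
     apply (simp add: data_read machines s2 del: sum_subtractf)
    unfolding m4_def[symmetric] by (rule final)
  show ?thesis
    unfolding zeta_step_def wp.simps(5)
    apply (rule wp_Store[where j = 0 and v = "\<zeta> k s"], simp, simp add: at data_read m read)
    apply (rule wp_Store[where j = "s * N + k" and v = z], simp add: at data_read m, rule z)
    apply (rule wp_Store[where j = 0 and v = "(\<Sum>j<k. \<zeta>' j s) + z"],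
        simp, simp add: at data_read m state)
    apply (rule wp_Store[where j = 0 and v = "(\<Sum>j<k. \<zeta> j s - \<zeta>' j s) + (\<zeta> k s - z)"],
        simp, simp add: at data_read m state del: sum_subtractf)
    apply (rule wp_Store[where j = "s * N + k" and v = "r1 k s"],
        simp add: at data_read m, simp add: at data_read m read r)
    apply (rule wp_Store[where j = "s * N + k" and v = "r2 k s"],
        simp add: at data_read m, simp add: at data_read m read r)
    apply (rule wp_Store[where j = "s * N + k" and v = "\<nu> k s + r1 k s"],
        simp add: at data_read m, simp add: at data_read m read)
    apply (rule wp_Store[where j = "s * N + k" and v = "\<psi> k s + r2 k s"],
        simp add: at data_read m, simp add: at data_read m read)
    apply (rule wp_Store[where j = "s * N + k" and v = "rho1 d * (\<zeta> k s - z)"],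
        simp add: at data_read m, simp add: at data_read m)
    unfolding m1_def[symmetric] unfolding m2_def[symmetric] unfolding m3_def[symmetric]
    apply (rule wp_Cond)
     apply (use last m in \<open>simp add: s1 machines\<close>)[1]
    apply (rule wp_Store[where j = "s * N + k" and v = "s1 k s"])
      apply (simp add: at data_read m machines)
     apply (use m in \<open>simp add: at data_read m machines read s1_def M_vec_def z_def\<close>)[1]
    using last by (simp only: set_mem_twice)
qed

lemma zeta_loop_set_reg [simp]:
  "r \<in> {''s'', ''k''} \<Longrightarrow> zeta_loop s k (set_reg r n m) = zeta_loop s k m"
  by (auto simp: zeta_loop_def)

text \<open>
  The two stores are those of \<open>zeta_end\<close>.
\<close>

lemma tz_done_column:
  assumes "tz_done s N m" and s: "s < S"
    and "set_mem ''phi'' s (\<phi> s + r3 s) (set_mem ''r3'' s (r3 s) m) = m'"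
  shows "tz_done (Suc s) 0 m'"
  using assms(1) s unfolding assms(3)[symmetric] tz_done_def
  by (auto simp: holds_mat_blend_column holds_prefix_column holds_vec_append holds_vec_def less_Suc_eq)

definition "tz_col_time =
  straight_cost riccati_init + ((3 + N * (straight_cost riccati_step + 4)) +
    (straight_cost zeta_init + ((3 + N * (straight_cost zeta_step + 4)) + straight_cost zeta_end)))"

lemma tz_column_correct:
  assumes s: "s < S" and m: "regs m ''s'' = s" "tz_done s 0 m"
  shows "reaches (riccati_init ;; For ''k'' ''N'' riccati_step ;; zeta_init ;;
      For ''k'' ''N'' zeta_step ;; zeta_end) tz_col_time
    (\<lambda>m'. regs m' ''s'' = s \<and> tz_done (Suc s) 0 m') m"
  unfolding tz_col_time_def
proof (intro reaches_Seq)
  let ?R = "\<lambda>i m. regs m ''s'' = s \<and> tz_done s 0 m \<and> riccati_done s i m"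
  let ?Z = "\<lambda>k m. regs m ''s'' = s \<and> zeta_loop s k m"
  show "reaches riccati_init (straight_cost riccati_init) (?R 0) m"
    using m by (intro reaches_wp) (simp add: riccati_init_def riccati_done_def holds_vec_def)
  show "reaches (For ''k'' ''N'' riccati_step) (3 + N * (straight_cost riccati_step + 4)) (?R N) m"
    if I: "?R 0 m" for m
  proof (rule reaches_For)
    fix i m
    assume i: "i < N" "regs m ''k'' = i" "regs m ''N'' = N" and I: "?R i m"
    then have I': "regs m ''s'' = s" "tz_done s 0 m" "riccati_done s i m" by auto
    show "reaches riccati_step (straight_cost riccati_step)
        (\<lambda>m'. regs m' ''k'' = i \<and> regs m' ''N'' = N \<and> ?R (Suc i) (set_reg ''k'' (Suc i) m')) m"
      by (rule reaches_wp, rule wp_mono[OF riccati_step_correct[OF s i(1) I'(1) i(2) I'(2,3)]])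
        (auto dest: tz_done_regs)
  qed (use I in \<open>auto dest: tz_done_regs\<close>)
  show "reaches zeta_init (straight_cost zeta_init) (?Z 0) m" if "?R N m" for m
    using that by (intro reaches_wp) (simp add: zeta_init_def zeta_loop_def)
  show "reaches (For ''k'' ''N'' zeta_step) (3 + N * (straight_cost zeta_step + 4)) (?Z N) m"
    if I: "?Z 0 m" for m
  proof (rule reaches_For)
    fix k m
    assume k: "k < N" "regs m ''k'' = k" "regs m ''N'' = N" and I: "?Z k m"
    then have I': "regs m ''s'' = s" "zeta_loop s k m" by auto
    show "reaches zeta_step (straight_cost zeta_step)
        (\<lambda>m'. regs m' ''k'' = k \<and> regs m' ''N'' = N \<and> ?Z (Suc k) (set_reg ''k'' (Suc k) m')) m"
      by (rule reaches_wp, rule wp_mono[OF zeta_step_correct[OF s k(1) I'(1) k(2) I'(2)]])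
        (auto dest: tz_done_regs simp: zeta_loop_def)
  qed (use I in \<open>auto dest: tz_done_regs simp: zeta_loop_def\<close>)
  show "reaches zeta_end (straight_cost zeta_end) (\<lambda>m'. regs m' ''s'' = s \<and> tz_done (Suc s) 0 m') m"
    if I: "?Z N m" for m
  proof -
    have loop_end: "tz_done s N m" and regs: "regs m ''s'' = s" "regs m ''N'' = N"
      using I by (auto simp: zeta_loop_def dest: tz_done_regs)
    note read = tz_done_read[OF loop_end s N_pos]
    show ?thesis
      by (rule reaches_wp)
        (use read regs in \<open>simp add: zeta_end_def at_0_def tz_done_column[OF loop_end s] r3_def\<close>)
  qed
qed

definition "tz_time = 3 + S * (tz_col_time + 4)"

lemma zeta_pass_correct:
  assumes m: "tz_done 0 0 m"
  shows "reaches zeta_pass tz_time (tz_done S 0) m"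
  unfolding zeta_pass_def tz_time_def
proof (rule reaches_For)
  fix s m
  assume "s < S" "regs m ''s'' = s" "tz_done s 0 m"
  from tz_column_correct[OF this]
  show "reaches (riccati_init ;; For ''k'' ''N'' riccati_step ;; zeta_init ;;
      For ''k'' ''N'' zeta_step ;; zeta_end) tz_col_time
      (\<lambda>m'. regs m' ''s'' = s \<and> regs m' ''S'' = S \<and> tz_done (Suc s) 0 (set_reg ''s'' (Suc s) m')) m"
    by (rule reaches_mono) (auto dest: tz_done_regs)
qed (use m in \<open>auto dest: tz_done_regs\<close>)

lemma admm_program_correct:
  assumes "holds_data m d" "holds_tz m d (\<tau>, \<zeta>)" "holds_mult m d (\<nu>, \<psi>, \<phi>)"
  shows "reaches admm_program (ux_time + tz_time) (tz_done S 0) m"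
  unfolding admm_program_def
  using assms by (intro reaches_Seq[OF ux_pass_correct zeta_pass_correct]) (simp_all add: ux_base_def)

end

section \<open>The time bound and the theorem\<close>

definition time_const :: nat where
  "time_const =
     straight_cost (set_num ''sum'' (Const 0) ;; set_num ''count'' (Const 0)) +
     straight_cost (set_num ''tau_old'' (num ''tau'') ;; set_num ''tau'' (num ''sum'' /\<^sub>a num ''count'')) +
     straight_cost (set_num ''level'' (Const 0)) + straight_cost ux_step + straight_cost ux_end +
     straight_cost riccati_init + straight_cost riccati_step +
     straight_cost zeta_init + straight_cost zeta_step + straight_cost zeta_end + 35"

text \<open>
  Both loop counts are at least 1, so lower-order terms are absorbed.
\<close>

lemma nested_loop_bound:
  assumes "n \<ge> 1" "k \<ge> (1::nat)"
  shows "a + k * (b + n * c) \<le> (a + b + c) * (n * k)"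
proof -
  have "1 \<le> n * k" using mult_le_mono[OF assms] by simp
  then have "a \<le> a * (n * k)" "k * b \<le> k * b * n"
    using assms mult_le_mono2[of 1 "n * k" a] mult_le_mono2[of 1 n "k * b"] by simp_all
  then have "a + k * b + k * (n * c) \<le> a * (n * k) + k * b * n + k * (n * c)"
    by (intro add_mono order_refl)
  then show ?thesis by (simp only: distrib_left distrib_right mult_ac add_ac)
qed

lemma (in admm_step) time_bound: "ux_time + tz_time \<le> time_const * (N * S)"
proof -
  define A where "A = straight_cost (set_num ''sum'' (Const 0) ;; set_num ''count'' (Const 0)) +
    straight_cost (set_num ''tau_old'' (num ''tau'') ;; set_num ''tau'' (num ''sum'' /\<^sub>a num ''count'')) + 6"
  define B where "B = straight_cost (set_num ''level'' (Const 0)) + straight_cost ux_end +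
    straight_cost riccati_init + straight_cost zeta_init + straight_cost zeta_end + 17"
  define C where "C = straight_cost ux_step + straight_cost riccati_step + straight_cost zeta_step + 12"
  have "ux_time + tz_time = A + S * (B + N * C)"
    by (simp add: ux_time_def tz_time_def ux_col_time_def tz_col_time_def A_def B_def C_def algebra_simps)
  also have "\<dots> \<le> (A + B + C) * (N * S)"
    using N_pos S_pos by (intro nested_loop_bound) auto
  also have "A + B + C = time_const"
    by (simp add: A_def B_def C_def time_const_def)
  finally show ?thesis .
qed

theorem mainTheorem2:
  shows "\<exists>(prog :: com) (C :: nat). \<forall>(d :: mpc) (xt :: tz) (l :: mult) (m :: machine).
    valid_mpc d \<and> holds_data m d \<and> holds_tz m d xt \<and> holds_mult m d l \<longrightarrow>
    (\<exists>t Z m' ut' xt' l' r s.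
       run prog m t Z m' \<and>
       admm_iteration d xt l ut' xt' l' r s \<and>
       holds_data m' d \<and> holds_ux m' d ut' \<and> holds_tz m' d xt' \<and> holds_mult m' d l' \<and>
       holds_residual_r m' d r \<and> holds_residual_s m' d s \<and>
       t \<le> C * (hor d * scen d) \<and>
       finite Z \<and> card Z \<le> C * (hor d * scen d))"
proof (rule exI[of _ admm_program], rule exI[of _ "8 * time_const"], intro allI impI, elim conjE)
  fix d :: mpc and xt :: tz and l :: mult and m :: machine
  assume valid: "valid_mpc d" and m: "holds_data m d" "holds_tz m d xt" "holds_mult m d l"
  obtain \<tau> \<zeta> where xt: "xt = (\<tau>, \<zeta>)" by (cases xt)
  obtain \<nu> \<psi> \<phi> where l: "l = (\<nu>, \<psi>, \<phi>)" by (cases l)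
  interpret admm_step d \<tau> \<zeta> \<nu> \<psi> \<phi> by standard (fact valid)
  from admm_program_correct m obtain t Z m' where run: "run admm_program m t Z m'"
    and t: "t \<le> ux_time + tz_time" and final: "tz_done S 0 m'"
    unfolding xt l reaches_def by blast
  let ?l = "(\<lambda>k s. \<nu> k s + r1 k s, \<lambda>k s. \<psi> k s + r2 k s, \<lambda>s. \<phi> s + r3 s)"
  have "holds_data m' d" "holds_ux m' d (u', x')" "holds_tz m' d (\<tau>', \<zeta>')" "holds_mult m' d ?l"
    "holds_residual_r m' d (r1, r2, r3)" "holds_residual_s m' d (s1, s2)"
    using final by (auto simp: tz_done_def tz_base_def holds_mat_blend_end holds_prefix_end holds_vec_def)
  moreover have "t \<le> time_const * (N * S)" using t time_bound by simp
  then have "t \<le> 8 * time_const * (N * S)" "8 * t \<le> 8 * time_const * (N * S)" by simp_all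
  moreover have "finite Z" "card Z \<le> 8 * t" using run_cells[OF run] by auto
  ultimately show "\<exists>t Z m' ut' xt' l' r s.
       run admm_program m t Z m' \<and>
       admm_iteration d xt l ut' xt' l' r s \<and>
       holds_data m' d \<and> holds_ux m' d ut' \<and> holds_tz m' d xt' \<and> holds_mult m' d l' \<and>
       holds_residual_r m' d r \<and> holds_residual_s m' d s \<and>
       t \<le> 8 * time_const * (hor d * scen d) \<and>
       finite Z \<and> card Z \<le> 8 * time_const * (hor d * scen d)"
    using run admm_iteration_new unfolding xt l by (meson order_trans)
qed

end
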